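(* Suppose that $g>1$ and let $\mathcal{C}_{1/2}:=2^{-1}\mathcal{C}\subset J$ be the preimage of $\mathcal{C}$ with respect to multiplication by $2$ in $J$. Then the intersection of $\mathcal{C}_{1/2}(K)$ and $\Theta$ consists of points of order dividing $2$ on $J$ (i.e., every point of $\mathcal{C}_{1/2}(K)\cap\Theta(K)$ is killed by $2$). In particular, the intersection of $\mathcal{C}$ and $\mathcal{C}_{1/2}$ consists of $\infty$ and all the points $\mathfrak{W}_i$ ($1\le i\le 2g+1$).
   Context: $K$ is an algebraically closed field of characteristic different from $2$, $g\ge 1$ is an integer, $\alpha_1,\dots,\alpha_{2g+1}$ are distinct elements of $K$, and $f(x)=\prod_{i=1}^{2g+1}(x-\alpha_i)$. $\mathcal{C}$ is the smooth projective model of the smooth affine plane $K$-curve $y^2=f(x)$; it is a genus $g$ hyperelliptic curve with exactly one infinite point, denoted $\infty$, so $\mathcal{C}(K)=\{(a,b)\in K^2\mid b^2=f(a)\}\sqcup\{\infty\}$. Put $\mathfrak{W}_i=(\alpha_i,0)\in\mathcal{C}(K)$. $J$ is the jacobian of $\mathcal{C}$, and for a degree zero divisor $D$ on $\mathcal{C}$, $\mathrm{cl}(D)\in J(K)$ is its linear equivalence class. $\mathcal{C}$ is identified with its image in $J$ under the canonical embedding $P\mapsto \mathrm{cl}((P)-(\infty))$, so that $\infty$ is the zero of the group law. For a positive integer $d\le g$, $\Theta_d\subset J$ is the image of the regular map $\mathcal{C}^d\to J$, $(Q_1,\dots,Q_d)\mapsto\sum_{i=1}^d Q_i$ (sum in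 $J$), and $\Theta:=\Theta_{g-1}$ is the theta divisor. *)

theory Defs
  imports
    "HOL-Algebra.Coset"
    "HOL-Algebra.Free_Abelian_Groups"
    "HOL-Algebra.Algebraic_Closure_Type"
    "HOL-Computational_Algebra.Fraction_Field"
    "HOL-Computational_Algebra.Polynomial"
begin

section \<open>The curve\<close>

definition hyp_poly :: "nat \<Rightarrow> (nat \<Rightarrow> 'a::field) \<Rightarrow> 'a poly" where
  "hyp_poly g \<alpha> = (\<Prod>i = 1..2 * g + 1. [:- \<alpha> i, 1:])"

datatype 'a hpoint = Aff 'a 'a | Infty

definition hcurve :: "nat \<Rightarrow> (nat \<Rightarrow> 'a::field) \<Rightarrow> 'a hpoint set" where
  "hcurve g \<alpha> = {Aff a b | a b. b ^ 2 = poly (hyp_poly g \<alpha>) a} \<union> {Infty}"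

section \<open>The function field\<close>

text \<open>
  The function field \<open>K(C) = K(x)[y]/(y\<^sup>2 - f(x))\<close> is realised as the subfield \<open>K(x)(y)\<close>, with
  \<open>y\<close> a square root of \<open>f(x)\<close>, of the algebraic closure of the field \<open>K(x)\<close> of rational
  functions. The two choices of \<open>y\<close> differ by an automorphism over \<open>K(x)\<close>; one is fixed.
\<close>

type_synonym 'a ratfun_closure = "'a poly fract alg_closure"

definition fun_of_poly :: "'a::field poly \<Rightarrow> 'a ratfun_closure" where
  "fun_of_poly p = to_ac (Fraction_Field.Fract p 1)"

definition fun_x :: "'a::field ratfun_closure" where
  "fun_x = fun_of_poly [:0, 1:]"

definition fun_y :: "nat \<Rightarrow> (nat \<Rightarrow> 'a::field) \<Rightarrow> 'a ratfun_closure" where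
  "fun_y g \<alpha> = (SOME y. y ^ 2 = fun_of_poly (hyp_poly g \<alpha>))"

definition function_field :: "nat \<Rightarrow> (nat \<Rightarrow> 'a::field) \<Rightarrow> 'a ratfun_closure set" where
  "function_field g \<alpha> = {to_ac r + to_ac s * fun_y g \<alpha> | r s. True}"

section \<open>Local rings and orders of vanishing\<close>

text \<open>
  A polynomial in two variables is an element of \<open>K[X][Y]\<close>, of type \<open>'a poly poly\<close>, so that \<open>Y\<close>
  is the outer variable.
\<close>

definition eval2 :: "'a::field poly poly \<Rightarrow> 'a \<Rightarrow> 'a \<Rightarrow> 'a" where
  "eval2 p a b = poly (poly p [:b:]) a"

definition fun_eval2 ::
  "'a::field poly poly \<Rightarrow> 'a ratfun_closure \<Rightarrow> 'a ratfun_closure \<Rightarrow> 'a ratfun_closure" where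
  "fun_eval2 p u v = poly (map_poly (\<lambda>q. poly (map_poly (\<lambda>c. fun_of_poly [:c:]) q) u) p) v"

text \<open>The local ring at \<open>(a, b)\<close> of the affine plane curve with coordinate functions \<open>u\<close> and \<open>v\<close>.\<close>

definition plane_local_ring ::
  "'a::field ratfun_closure \<Rightarrow> 'a ratfun_closure \<Rightarrow> 'a \<Rightarrow> 'a \<Rightarrow> 'a ratfun_closure set" where
  "plane_local_ring u v a b = {fun_eval2 p u v / fun_eval2 q u v | p q. eval2 q a b \<noteq> 0}"

text \<open>
  The smooth projective model is glued from the affine curve \<open>y\<^sup>2 = f(x)\<close> and the affine curve
  \<open>v\<^sup>2 = u\<^bsup>2g+2\<^esup> f(1/u) = u \<Prod>\<^sub>i (1 - \<alpha>\<^sub>i u)\<close> along \<open>u = 1/x\<close>, \<open>v = y/x\<^bsup>g+1\<^esup>\<close>. The point at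
  infinity is \<open>(u, v) = (0, 0)\<close> on the second one.
\<close>

fun local_ring :: "nat \<Rightarrow> (nat \<Rightarrow> 'a::field) \<Rightarrow> 'a hpoint \<Rightarrow> 'a ratfun_closure set" where
  "local_ring g \<alpha> (Aff a b) = plane_local_ring fun_x (fun_y g \<alpha>) a b"
| "local_ring g \<alpha> Infty = plane_local_ring (1 / fun_x) (fun_y g \<alpha> / fun_x ^ (g + 1)) 0 0"

definition local_units :: "nat \<Rightarrow> (nat \<Rightarrow> 'a::field) \<Rightarrow> 'a hpoint \<Rightarrow> 'a ratfun_closure set" where
  "local_units g \<alpha> P = {h \<in> local_ring g \<alpha> P. h \<noteq> 0 \<and> inverse h \<in> local_ring g \<alpha> P}"

text \<open>A uniformizer is a generator of the maximal ideal, i.e. of the set of non-units.\<close>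

definition uniformizer ::
  "nat \<Rightarrow> (nat \<Rightarrow> 'a::field) \<Rightarrow> 'a hpoint \<Rightarrow> 'a ratfun_closure \<Rightarrow> bool" where
  "uniformizer g \<alpha> P t \<longleftrightarrow>
     t \<in> local_ring g \<alpha> P \<and>
     local_ring g \<alpha> P - local_units g \<alpha> P = (\<lambda>h. t * h) ` local_ring g \<alpha> P"

text \<open>Meaningful for \<open>P\<close> on the curve and \<open>h\<close> a nonzero element of the function field.\<close>

definition ord_at :: "nat \<Rightarrow> (nat \<Rightarrow> 'a::field) \<Rightarrow> 'a hpoint \<Rightarrow> 'a ratfun_closure \<Rightarrow> int" where
  "ord_at g \<alpha> P h =
     (THE n. \<exists>t u. uniformizer g \<alpha> P t \<and> u \<in> local_units g \<alpha> P \<and> h = t powi n * u)"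

section \<open>Divisors and the jacobian\<close>

abbreviation divisor_group :: "nat \<Rightarrow> (nat \<Rightarrow> 'a::field) \<Rightarrow> ('a hpoint \<Rightarrow>\<^sub>0 int) monoid" where
  "divisor_group g \<alpha> \<equiv> free_Abelian_group (hcurve g \<alpha>)"

definition div_degree :: "('a hpoint \<Rightarrow>\<^sub>0 int) \<Rightarrow> int" where
  "div_degree D = (\<Sum>P \<in> Poly_Mapping.keys D. Poly_Mapping.lookup D P)"

definition principal_divisors ::
  "nat \<Rightarrow> (nat \<Rightarrow> 'a::field) \<Rightarrow> ('a hpoint \<Rightarrow>\<^sub>0 int) set" where
  "principal_divisors g \<alpha> =
     {D \<in> carrier (divisor_group g \<alpha>).
        \<exists>h \<in> function_field g \<alpha> - {0}.
          \<forall>P \<in> hcurve g \<alpha>. Poly_Mapping.lookup D P = ord_at g \<alpha> P h}"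

definition picard_group :: "nat \<Rightarrow> (nat \<Rightarrow> 'a::field) \<Rightarrow> ('a hpoint \<Rightarrow>\<^sub>0 int) set monoid" where
  "picard_group g \<alpha> = divisor_group g \<alpha> Mod principal_divisors g \<alpha>"

definition cl :: "nat \<Rightarrow> (nat \<Rightarrow> 'a::field) \<Rightarrow> ('a hpoint \<Rightarrow>\<^sub>0 int) \<Rightarrow> ('a hpoint \<Rightarrow>\<^sub>0 int) set" where
  "cl g \<alpha> D = principal_divisors g \<alpha> #>\<^bsub>divisor_group g \<alpha>\<^esub> D"

text \<open>
  The group \<open>J(K)\<close>: the subgroup of the Picard group formed by the classes of divisors of degree
  zero. Following HOL-Algebra, its group law is written multiplicatively.
\<close>

definition jacobian :: "nat \<Rightarrow> (nat \<Rightarrow> 'a::field) \<Rightarrow> ('a hpoint \<Rightarrow>\<^sub>0 int) set monoid" where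
  "jacobian g \<alpha> = (picard_group g \<alpha>)
     \<lparr>carrier := cl g \<alpha> ` {D \<in> carrier (divisor_group g \<alpha>). div_degree D = 0}\<rparr>"

definition jac_embed :: "nat \<Rightarrow> (nat \<Rightarrow> 'a::field) \<Rightarrow> 'a hpoint \<Rightarrow> ('a hpoint \<Rightarrow>\<^sub>0 int) set" where
  "jac_embed g \<alpha> P = cl g \<alpha> (frag_of P - frag_of Infty)"

text \<open>
  The following sets are the sets of \<open>K\<close>-points of the respective closed subsets of \<open>J\<close>. As \<open>K\<close> is
  algebraically closed, the \<open>K\<close>-points of the image of \<open>C\<^sup>d\<close> in \<open>J\<close> are the images of the \<open>K\<close>-points.
\<close>

definition jac_curve :: "nat \<Rightarrow> (nat \<Rightarrow> 'a::field) \<Rightarrow> ('a hpoint \<Rightarrow>\<^sub>0 int) set set" where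
  "jac_curve g \<alpha> = jac_embed g \<alpha> ` hcurve g \<alpha>"

definition jac_half_curve :: "nat \<Rightarrow> (nat \<Rightarrow> 'a::field) \<Rightarrow> ('a hpoint \<Rightarrow>\<^sub>0 int) set set" where
  "jac_half_curve g \<alpha> =
     {z \<in> carrier (jacobian g \<alpha>). z [^]\<^bsub>jacobian g \<alpha>\<^esub> (2::nat) \<in> jac_curve g \<alpha>}"

definition jac_theta :: "nat \<Rightarrow> (nat \<Rightarrow> 'a::field) \<Rightarrow> nat \<Rightarrow> ('a hpoint \<Rightarrow>\<^sub>0 int) set set" where
  "jac_theta g \<alpha> d =
     {finprod (jacobian g \<alpha>) (\<lambda>i. jac_embed g \<alpha> (Q i)) {1..d} | Q. Q \<in> {1..d} \<rightarrow> hcurve g \<alpha>}"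

abbreviation theta_divisor :: "nat \<Rightarrow> (nat \<Rightarrow> 'a::field) \<Rightarrow> ('a hpoint \<Rightarrow>\<^sub>0 int) set set" where
  "theta_divisor g \<alpha> \<equiv> jac_theta g \<alpha> (g - 1)"

end

theory Submission
  imports Defs
begin

text \<open>
  Let \<open>z\<close> be the class of \<open>D = \<Sum>\<^sub>i ((Q\<^sub>i) - (\<infinity>))\<close> with \<open>g - 1\<close> points \<open>Q\<^sub>i\<close>, and suppose that \<open>2z\<close> is the
  class of \<open>(P) - (\<infinity>)\<close>. If \<open>P = \<infinity>\<close>, then \<open>2z = 0\<close>. Otherwise \<open>P = (a, b)\<close> is affine and
  \<open>2D - (P) + (\<infinity>)\<close> is the divisor of a function \<open>h\<close>. The function \<open>h (x - a)\<close> has no affine poles,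
  and at \<open>\<infinity>\<close> its pole has order at most \<open>2g - 1\<close>. A function without affine poles is \<open>A(x) + B(x) y\<close>,
  and \<open>y\<close> has a pole of order \<open>2g + 1\<close> at \<open>\<infinity>\<close>, so \<open>B = 0\<close> (\<open>low_pole_imp_polynomial\<close>). Hence \<open>h\<close> is a
  function of \<open>x\<close> alone. Such a function has even order at the Weierstrass points and equal orders at
  \<open>(a, b)\<close> and \<open>(a, -b)\<close>; but \<open>2D - (P)\<close> is odd at \<open>P\<close> and even at all other affine points, a
  contradiction (\<open>double_not_equivalent_affine_point\<close>).

  As \<open>g > 1\<close>, this applies to \<open>D = (P) - (\<infinity>)\<close> as well: a point of the curve that lies on the half of the
  curve is killed by 2. If \<open>2(P) - 2(\<infinity>)\<close> is principal with \<open>P\<close> affine, it is again the divisor of a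
  polynomial in \<open>x\<close>, hence symmetric under \<open>y \<mapsto> -y\<close>, which forces \<open>b = 0\<close>
  (\<open>two_torsion_imp_weierstrass\<close>). Conversely \<open>x - \<alpha>\<^sub>i\<close> has divisor \<open>2(W\<^sub>i) - 2(\<infinity>)\<close>.

  The orders of vanishing come from the local rings, so each local ring must be shown to be a discrete
  valuation ring with an explicit uniformizer: \<open>u - a\<close> at an unramified point of a chart
  \<open>v\<^sup>2 = F(u)\<close>, and \<open>v\<close> at a branch point. This is done for an arbitrary such chart (\<open>smooth_point\<close>,
  with \<open>ord_at_eq\<close> as its outcome) and then used for the affine chart and for the chart at infinity.
\<close>

section \<open>Substitution into polynomials\<close>

lemma poly_map_poly_hom:
  fixes c :: "'b::comm_ring_1 \<Rightarrow> 'c::comm_ring_1"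
  assumes "c 0 = 0" "\<And>p q. c (p + q) = c p + c q" "\<And>p q. c (p * q) = c p * c q"
  shows "poly (map_poly c (p + q)) t = poly (map_poly c p) t + poly (map_poly c q) t"
    and "poly (map_poly c (p * q)) t = poly (map_poly c p) t * poly (map_poly c q) t"
proof -
  show add: "poly (map_poly c (p + q)) t = poly (map_poly c p) t + poly (map_poly c q) t" for p q
    by (induction p q rule: poly_induct2) (simp_all add: map_poly_pCons assms algebra_simps)
  have smult: "poly (map_poly c (smult k q)) t = c k * poly (map_poly c q) t" for k q
    by (simp add: map_poly_smult assms)
  show "poly (map_poly c (p * q)) t = poly (map_poly c p) t * poly (map_poly c q) t"
    by (induction p) (simp_all add: add smult map_poly_pCons assms algebra_simps)
qed

lemma fun_of_poly_0 [simp]: "fun_of_poly 0 = 0"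
  by (simp add: fun_of_poly_def flip: Zero_fract_def)

lemma fun_of_poly_1 [simp]: "fun_of_poly 1 = 1"
  by (simp add: fun_of_poly_def flip: One_fract_def)

lemma fun_of_poly_add: "fun_of_poly (p + q) = fun_of_poly p + fun_of_poly q"
  by (simp add: fun_of_poly_def flip: to_ac_add)

lemma fun_of_poly_mult: "fun_of_poly (p * q) = fun_of_poly p * fun_of_poly q"
  by (simp add: fun_of_poly_def flip: to_ac_mult)

lemma fun_of_poly_eq_0_iff: "fun_of_poly p = 0 \<longleftrightarrow> p = 0"
  by (simp add: fun_of_poly_def Zero_fract_def eq_fract)

text \<open>The function \<open>p(u)\<close>, for a function \<open>u\<close> in place of the variable of \<open>p\<close>.\<close>
definition subst_poly :: "'a::field ratfun_closure \<Rightarrow> 'a poly \<Rightarrow> 'a ratfun_closure" where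
  "subst_poly u p = poly (map_poly (\<lambda>c. fun_of_poly [:c:]) p) u"

lemma fun_eval2_eq: "fun_eval2 p u v = poly (map_poly (subst_poly u) p) v"
  by (simp add: fun_eval2_def subst_poly_def[abs_def])

lemma subst_poly_0 [simp]: "subst_poly u 0 = 0"
  by (simp add: subst_poly_def)

lemma subst_poly_1 [simp]: "subst_poly u 1 = 1"
  by (simp add: subst_poly_def flip: one_pCons)

lemma subst_poly_pCons: "subst_poly u (pCons c p) = fun_of_poly [:c:] + u * subst_poly u p"
  by (simp add: subst_poly_def map_poly_pCons)

lemma subst_poly_add [simp]: "subst_poly u (p + q) = subst_poly u p + subst_poly u q"
  unfolding subst_poly_def
  by (intro poly_map_poly_hom) (simp_all add: mult.commute flip: fun_of_poly_add fun_of_poly_mult)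

lemma subst_poly_mult [simp]: "subst_poly u (p * q) = subst_poly u p * subst_poly u q"
  unfolding subst_poly_def
  by (intro poly_map_poly_hom) (simp_all add: mult.commute flip: fun_of_poly_add fun_of_poly_mult)

lemma subst_poly_minus [simp]: "subst_poly u (- p) = - subst_poly u p"
  using subst_poly_add[of u p "- p"] by (simp add: eq_neg_iff_add_eq_0 add.commute)

lemma subst_poly_diff [simp]: "subst_poly u (p - q) = subst_poly u p - subst_poly u q"
  using subst_poly_add[of u p "- q"] by simp

lemma subst_poly_power [simp]: "subst_poly u (p ^ n) = subst_poly u p ^ n"
  by (induction n) simp_all

section \<open>Double covers of the line\<close>

text \<open>
  Both affine charts of the curve are double covers \<open>v\<^sup>2 = F(u)\<close> of a line, one with \<open>u = x\<close> and one
  with \<open>u = 1/x\<close>. The local theory depends on nothing else and is developed once for both. A root of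
  odd order of \<open>F\<close> keeps \<open>F\<close> from being a square in \<open>K(u)\<close>, so that \<open>1, v\<close> are independent
  over \<open>K(u)\<close>.
\<close>
locale double_cover =
  fixes F :: "'a::alg_closed_field poly" and u v :: "'a ratfun_closure"
  assumes two: "(2::'a) \<noteq> 0"
    and transcendental: "subst_poly u p = 0 \<Longrightarrow> p = 0"
    and v_square: "v ^ 2 = subst_poly u F"
    and F_nonzero: "F \<noteq> 0"
    and odd_order: "\<exists>c. odd (order c F)"
begin

abbreviation ev :: "'a poly \<Rightarrow> 'a ratfun_closure" where "ev \<equiv> subst_poly u"

definition lin :: "'a poly \<Rightarrow> 'a poly \<Rightarrow> 'a ratfun_closure" where
  "lin A B = ev A + ev B * v"

lemma ev_eq_0_iff [simp]: "ev p = 0 \<longleftrightarrow> p = 0"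
  using transcendental by auto

lemma ev_eq_iff [simp]: "ev p = ev q \<longleftrightarrow> p = q"
  using ev_eq_0_iff[of "p - q"] by (simp del: ev_eq_0_iff)

text \<open>
  A relation \<open>A + B v = 0\<close> would give \<open>A\<^sup>2 = B\<^sup>2 F\<close>, where the two sides have orders of different
  parity at a root of odd order of \<open>F\<close>.
\<close>
lemma lin_eq_0_iff [simp]: "lin A B = 0 \<longleftrightarrow> A = 0 \<and> B = 0"
proof
  assume *: "lin A B = 0"
  then have "ev A ^ 2 = ev B ^ 2 * v ^ 2"
    unfolding lin_def by (metis add_eq_0_iff power2_minus power_mult_distrib)
  then have "ev (A ^ 2) = ev (B ^ 2 * F)" by (simp add: v_square)
  then have eq: "A ^ 2 = B ^ 2 * F" by (simp only: ev_eq_iff)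
  have "B = 0"
  proof (rule ccontr)
    assume B: "B \<noteq> 0"
    with eq F_nonzero have A: "A \<noteq> 0" by auto
    obtain c where c: "odd (order c F)" using odd_order by blast
    have "order c (A * A) = order c A + order c A" using A by (simp add: order_mult)
    moreover have "order c (B * B * F) = order c B + order c B + order c F"
      using B F_nonzero by (simp add: order_mult)
    ultimately show False using eq c by (simp add: power2_eq_square) presburger
  qed
  with eq show "A = 0 \<and> B = 0" by simp
qed (simp add: lin_def)

lemma lin_diff: "lin A B - lin A' B' = lin (A - A') (B - B')"
  by (simp add: lin_def algebra_simps)

lemma lin_eq_iff: "lin A B = lin A' B' \<longleftrightarrow> A = A' \<and> B = B'"
  using lin_eq_0_iff[of "A - A'" "B - B'"] by (simp del: lin_eq_0_iff flip: lin_diff)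

lemma lin_add: "lin A B + lin A' B' = lin (A + A') (B + B')"
  by (simp add: lin_def algebra_simps)

lemma lin_mult: "lin A B * lin A' B' = lin (A * A' + B * B' * F) (A * B' + B * A')"
proof -
  have "lin A B * lin A' B' = ev A * ev A' + ev B * ev B' * v ^ 2 + (ev A * ev B' + ev B * ev A') * v"
    by (simp add: lin_def algebra_simps power2_eq_square)
  then show ?thesis by (simp add: lin_def v_square)
qed

lemma lin_0_right: "lin A 0 = ev A"
  by (simp add: lin_def)

lemma lin_conjugate: "lin A B * lin A (- B) = ev (A ^ 2 - B ^ 2 * F)"
  by (simp add: lin_mult lin_0_right power2_eq_square mult.assoc)

lemma norm_nonzero: "lin A B \<noteq> 0 \<Longrightarrow> A ^ 2 - B ^ 2 * F \<noteq> 0"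
  by (metis ev_eq_0_iff lin_conjugate lin_eq_0_iff mult_eq_0_iff neg_equal_0_iff_equal)

text \<open>Every polynomial in \<open>X, Y\<close> is congruent to one of degree at most 1 in \<open>Y\<close> modulo \<open>Y\<^sup>2 - F\<close>.\<close>
lemma fun_eval2_normal_form:
  "\<exists>A B. fun_eval2 p u v = lin A B \<and>
         (\<forall>a b. b ^ 2 = poly F a \<longrightarrow> eval2 p a b = poly A a + poly B a * b)"
proof (induction p)
  case 0
  show ?case by (intro exI[of _ 0]) (simp add: fun_eval2_eq eval2_def)
next
  case (pCons c p)
  then obtain A B where 1: "fun_eval2 p u v = lin A B"
    and 2: "b ^ 2 = poly F a \<Longrightarrow> eval2 p a b = poly A a + poly B a * b" for a b by blast
  have "fun_eval2 (pCons c p) u v = lin c 0 + lin 0 1 * fun_eval2 p u v"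
    by (simp add: fun_eval2_eq map_poly_pCons lin_def)
  also have "\<dots> = lin (c + B * F) A" by (simp add: 1 lin_mult lin_add)
  finally have "fun_eval2 (pCons c p) u v = lin (c + B * F) A" .
  moreover have "eval2 (pCons c p) a b = poly (c + B * F) a + poly A a * b"
    if "b ^ 2 = poly F a" for a b
  proof -
    have "eval2 (pCons c p) a b = poly c a + b * eval2 p a b" by (simp add: eval2_def)
    also have "\<dots> = poly (c + B * F) a + poly A a * b"
      by (simp add: 2 that algebra_simps power2_eq_square flip: that)
    finally show ?thesis .
  qed
  ultimately show ?case by blast
qed

end

section \<open>The discrete valuation at a smooth point\<close>

text \<open>
  The second condition is the smoothness of the plane curve \<open>Y\<^sup>2 = F(X)\<close> at \<open>(a, b)\<close>: the partial
  derivative \<open>2Y\<close> vanishes only where \<open>b = 0\<close>, and there \<open>F\<close> must have a simple root.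
\<close>
locale smooth_point = double_cover +
  fixes a b :: 'a
  assumes on_curve: "b ^ 2 = poly F a"
    and smooth: "b = 0 \<Longrightarrow> order a F = 1"
begin

definition val :: "'a poly \<Rightarrow> 'a poly \<Rightarrow> 'a" where
  "val A B = poly A a + poly B a * b"

text \<open>
  The fractions of functions that do not vanish at \<open>(a, b)\<close>; they turn out to be exactly the units of
  the local ring (\<open>loc_units_iff\<close>).
\<close>
definition loc_units :: "'a ratfun_closure set" where
  "loc_units = {lin A B / lin C D | A B C D. val A B \<noteq> 0 \<and> val C D \<noteq> 0}"

abbreviation loc_ring :: "'a ratfun_closure set" where
  "loc_ring \<equiv> plane_local_ring u v a b"

text \<open>
  The projection to the line with coordinate \<open>u\<close> is unramified where \<open>b \<noteq> 0\<close>, so \<open>u - a\<close> is a local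
  parameter; at a branch point \<open>u - a\<close> has a double zero and \<open>v\<close> takes its place.
\<close>
definition unif :: "'a ratfun_closure" where
  "unif = (if b = 0 then v else ev [:- a, 1:])"

text \<open>
  Orders with respect to the one explicit parameter \<open>unif\<close>; \<open>ord_at_eq\<close> shows that they are the
  orders defined through arbitrary uniformizers.
\<close>
definition has_order :: "'a ratfun_closure \<Rightarrow> int \<Rightarrow> bool" where
  "has_order h n \<longleftrightarrow> (\<exists>w \<in> loc_units. h = unif powi n * w)"

lemma unif_ramified: "b = 0 \<Longrightarrow> unif = v"
  and unif_unramified: "b \<noteq> 0 \<Longrightarrow> unif = ev [:- a, 1:]"
  unfolding unif_def by simp_all

lemma val_mult: "val (A * A' + B * B' * F) (A * B' + B * A') = val A B * val A' B'"
proof -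
  have "val A B * val A' B' = poly A a * poly A' a + poly B a * poly B' a * b ^ 2
      + (poly A a * poly B' a + poly B a * poly A' a) * b"
    by (simp add: val_def algebra_simps power2_eq_square)
  then show ?thesis by (simp add: val_def on_curve)
qed

lemma val_nonzero_imp: "val A B \<noteq> 0 \<Longrightarrow> lin A B \<noteq> 0"
  by (auto simp: val_def)

lemma loc_ring_iff: "h \<in> loc_ring \<longleftrightarrow> (\<exists>A B C D. h = lin A B / lin C D \<and> val C D \<noteq> 0)"
proof
  assume "h \<in> loc_ring"
  then obtain p q where h: "h = fun_eval2 p u v / fun_eval2 q u v" and q: "eval2 q a b \<noteq> 0"
    by (auto simp: plane_local_ring_def)
  obtain A B where "fun_eval2 p u v = lin A B" using fun_eval2_normal_form by blast
  moreover obtain C D where "fun_eval2 q u v = lin C D" "eval2 q a b = val C D"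
    using fun_eval2_normal_form[of q] on_curve by (auto simp: val_def)
  ultimately show "\<exists>A B C D. h = lin A B / lin C D \<and> val C D \<noteq> 0" using h q by metis
next
  assume "\<exists>A B C D. h = lin A B / lin C D \<and> val C D \<noteq> 0"
  then obtain A B C D where h: "h = lin A B / lin C D" and CD: "val C D \<noteq> 0" by blast
  have lin: "lin A B = fun_eval2 [:A, B:] u v" for A B
    by (simp add: lin_def fun_eval2_eq map_poly_pCons mult.commute)
  have "eval2 [:C, D:] a b = val C D" by (simp add: eval2_def val_def mult.commute)
  then show "h \<in> loc_ring" unfolding plane_local_ring_def
    by (intro CollectI exI[of _ "[:A, B:]"] exI[of _ "[:C, D:]"]) (simp add: h CD flip: lin)
qed

text \<open>The value at \<open>(a, b)\<close> of a function in the local ring does not depend on the fraction.\<close>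
lemma val_cross:
  assumes "lin A B / lin C D = lin A' B' / lin C' D'" "val C D \<noteq> 0" "val C' D' \<noteq> 0"
  shows "val A B * val C' D' = val A' B' * val C D"
proof -
  have "lin A B * lin C' D' = lin A' B' * lin C D"
    using assms val_nonzero_imp by (simp add: frac_eq_eq del: lin_eq_0_iff)
  then show ?thesis by (simp add: lin_mult lin_eq_iff flip: val_mult)
qed

lemma loc_ring_cross_mult:
  assumes "lin A B / ev C \<in> loc_ring" "C \<noteq> 0"
  shows "\<exists>A' B' C' D'. lin A B * lin C' D' = lin A' B' * lin C 0 \<and> val C' D' \<noteq> 0"
proof -
  obtain A' B' C' D' where h: "lin A B / ev C = lin A' B' / lin C' D'" "val C' D' \<noteq> 0"
    using assms(1) unfolding loc_ring_iff by blast
  then have "lin A B * lin C' D' = lin A' B' * lin C 0"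
    using assms(2) val_nonzero_imp[OF h(2)]
    by (simp add: lin_0_right frac_eq_eq del: lin_eq_0_iff)
  then show ?thesis using h(2) by blast
qed

lemma loc_unitsI: "val A B \<noteq> 0 \<Longrightarrow> lin A B \<in> loc_units"
  unfolding loc_units_def
  by (intro CollectI exI[of _ A] exI[of _ B] exI[of _ 1] exI[of _ 0]) (simp add: val_def lin_def)

lemma loc_units_1: "1 \<in> loc_units"
  using loc_unitsI[of 1 0] by (simp add: val_def lin_def)

lemma loc_units_nonzero: "h \<in> loc_units \<Longrightarrow> h \<noteq> 0"
  using val_nonzero_imp by (auto simp: loc_units_def simp del: lin_eq_0_iff)

lemma loc_units_mult:
  assumes "h \<in> loc_units" "k \<in> loc_units" shows "h * k \<in> loc_units"
proof -
  obtain A B C D A' B' C' D' where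
    "h = lin A B / lin C D" "val A B \<noteq> 0" "val C D \<noteq> 0"
    "k = lin A' B' / lin C' D'" "val A' B' \<noteq> 0" "val C' D' \<noteq> 0"
    using assms by (auto simp: loc_units_def)
  then have "h * k = lin (A * A' + B * B' * F) (A * B' + B * A') / lin (C * C' + D * D' * F) (C * D' + D * C')"
    "val (A * A' + B * B' * F) (A * B' + B * A') \<noteq> 0" "val (C * C' + D * D' * F) (C * D' + D * C') \<noteq> 0"
    by (simp_all add: val_mult flip: lin_mult)
  then show ?thesis by (auto simp: loc_units_def)
qed

lemma loc_units_inverse: "h \<in> loc_units \<Longrightarrow> inverse h \<in> loc_units"
  unfolding loc_units_def by clarsimp (metis (no_types))

lemma loc_units_divide: "h \<in> loc_units \<Longrightarrow> k \<in> loc_units \<Longrightarrow> h / k \<in> loc_units"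
  using loc_units_mult loc_units_inverse by (simp add: divide_inverse)

lemma loc_units_power: "h \<in> loc_units \<Longrightarrow> h ^ n \<in> loc_units"
  by (induction n) (auto intro: loc_units_1 loc_units_mult)

lemma loc_units_powi: "h \<in> loc_units \<Longrightarrow> h powi n \<in> loc_units"
  by (simp add: power_int_def loc_units_power loc_units_inverse flip: power_inverse)

lemma loc_units_subset: "loc_units \<subseteq> loc_ring"
  unfolding loc_units_def by clarify (auto simp only: loc_ring_iff)

lemma loc_ring_mult:
  assumes "h \<in> loc_ring" "k \<in> loc_ring" shows "h * k \<in> loc_ring"
proof -
  obtain A B C D A' B' C' D' where
    "h = lin A B / lin C D" "val C D \<noteq> 0" "k = lin A' B' / lin C' D'" "val C' D' \<noteq> 0"
    using assms by (auto simp: loc_ring_iff)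
  then have "h * k = lin (A * A' + B * B' * F) (A * B' + B * A') / lin (C * C' + D * D' * F) (C * D' + D * C')"
     "val (C * C' + D * D' * F) (C * D' + D * C') \<noteq> 0"
    by (simp_all add: val_mult flip: lin_mult)
  then show ?thesis unfolding loc_ring_iff by blast
qed

lemma lin_in_loc_ring: "lin A B \<in> loc_ring"
  unfolding loc_ring_iff
  by (intro exI[of _ A] exI[of _ B] exI[of _ 1] exI[of _ 0]) (simp add: val_def lin_def)

lemma loc_ring_power: "h \<in> loc_ring \<Longrightarrow> h ^ n \<in> loc_ring"
  using loc_units_1 loc_units_subset by (induction n) (auto intro: loc_ring_mult)

text \<open>
  If \<open>h\<close> and \<open>1/h\<close> are both fractions with denominators nonzero at the point, then comparing values in
  \<open>h \<cdot> 1/h = 1\<close> shows that the numerator of \<open>h\<close> is nonzero there as well.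
\<close>
lemma loc_units_iff: "h \<in> loc_units \<longleftrightarrow> h \<in> loc_ring \<and> h \<noteq> 0 \<and> inverse h \<in> loc_ring"
proof
  assume "h \<in> loc_units"
  then show "h \<in> loc_ring \<and> h \<noteq> 0 \<and> inverse h \<in> loc_ring"
    using loc_units_inverse loc_units_nonzero loc_units_subset by blast
next
  assume *: "h \<in> loc_ring \<and> h \<noteq> 0 \<and> inverse h \<in> loc_ring"
  then obtain A B C D A' B' C' D' where
    h: "h = lin A B / lin C D" "val C D \<noteq> 0"
    and h': "inverse h = lin A' B' / lin C' D'" "val C' D' \<noteq> 0"
    by (auto simp: loc_ring_iff)
  have nz: "lin C D \<noteq> 0" "lin C' D' \<noteq> 0" using h h' val_nonzero_imp by blast+
  have "h * inverse h = 1" using * by simp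
  then have "lin A B * lin A' B' = lin C D * lin C' D'"
    using nz by (simp add: h'(1) del: lin_eq_0_iff) (simp add: h field_simps del: lin_eq_0_iff)
  then have "val A B * val A' B' = val C D * val C' D'"
    by (simp add: lin_mult lin_eq_iff flip: val_mult)
  then have "val A B \<noteq> 0" using h h' by auto
  with h show "h \<in> loc_units" by (auto simp: loc_units_def)
qed

lemma v_nonzero: "v \<noteq> 0"
  using v_square F_nonzero by auto

lemma unif_nonzero: "unif \<noteq> 0"
  by (simp add: unif_def v_nonzero)

lemma unif_eq_lin: "\<exists>A B. unif = lin A B \<and> val A B = 0"
proof (cases "b = 0")
  case True
  have "unif = lin 0 1" by (simp add: unif_ramified[OF True] lin_def)
  moreover have "val 0 1 = 0" unfolding val_def using True by simp
  ultimately show ?thesis by blast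
next
  case False
  then have "unif = lin [:- a, 1:] 0" by (simp add: unif_unramified lin_0_right)
  moreover have "val [:- a, 1:] 0 = 0" by (simp add: val_def)
  ultimately show ?thesis by blast
qed

lemma unif_in_loc_ring: "unif \<in> loc_ring"
  using unif_eq_lin lin_in_loc_ring by auto

lemma lin_not_loc_unit: "val A B = 0 \<Longrightarrow> lin A B \<notin> loc_units"
proof
  assume val: "val A B = 0" and "lin A B \<in> loc_units"
  then obtain A' B' C' D' where "lin A B = lin A' B' / lin C' D'" "val A' B' \<noteq> 0" "val C' D' \<noteq> 0"
    by (auto simp: loc_units_def)
  then show False using val_cross[of A B 1 0 A' B' C' D'] val by (simp add: val_def lin_0_right)
qed

lemma unif_not_unit: "unif \<notin> loc_units"
  using unif_eq_lin lin_not_loc_unit by auto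

text \<open>
  A negative or positive power of \<open>unif\<close> that is a unit would make \<open>unif\<close> itself a unit. This is what
  makes orders unique.
\<close>
lemma unif_power_unit_imp: assumes "unif powi n \<in> loc_units" shows "n = 0"
proof -
  have pos: False if "unif ^ Suc m \<in> loc_units" for m
  proof -
    have "inverse (unif ^ Suc m) \<in> loc_ring"
      using that loc_units_iff by blast
    then have "inverse (unif ^ Suc m) * unif ^ m \<in> loc_ring"
      using loc_ring_mult loc_ring_power unif_in_loc_ring by blast
    moreover have "inverse (unif ^ Suc m) * unif ^ m = inverse unif"
      using unif_nonzero by (simp add: field_simps)
    ultimately show False
      using unif_not_unit unif_nonzero unif_in_loc_ring loc_units_iff by metis
  qed
  show ?thesis
  proof (cases n "0::int" rule: linorder_cases)
    case less
    then have "inverse (unif powi n) = unif ^ Suc (nat (- n) - 1)"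
      by (simp add: power_int_def flip: power_inverse)
    then show ?thesis using pos assms loc_units_inverse by metis
  next
    case greater
    then have "unif powi n = unif ^ Suc (nat n - 1)" by (simp add: power_int_def)
    then show ?thesis using pos assms by metis
  qed
qed

lemma has_order_unique: assumes "has_order h n" "has_order h m" shows "n = m"
proof -
  obtain w w' where w: "w \<in> loc_units" "w' \<in> loc_units" "unif powi n * w = unif powi m * w'"
    using assms by (auto simp: has_order_def)
  then have "unif powi (n - m) = w' / w"
    using unif_nonzero loc_units_nonzero by (simp add: power_int_diff field_simps)
  then show ?thesis using unif_power_unit_imp[of "n - m"] w loc_units_divide by simp
qed

lemma has_order_mult: "has_order h n \<Longrightarrow> has_order k m \<Longrightarrow> has_order (h * k) (n + m)"
  unfolding has_order_def
  by (auto intro!: bexI[of _ "_ * _"] simp: loc_units_mult power_int_add unif_nonzero mult_ac)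

lemma has_order_inverse: "has_order h n \<Longrightarrow> has_order (inverse h) (- n)"
  unfolding has_order_def
  by (auto intro!: bexI[of _ "inverse _"] loc_units_inverse simp: power_int_minus)

lemma has_order_divide: "has_order h n \<Longrightarrow> has_order k m \<Longrightarrow> has_order (h / k) (n - m)"
  using has_order_mult[OF _ has_order_inverse] by (simp add: divide_inverse)

lemma has_order_power: "has_order h n \<Longrightarrow> has_order (h ^ k) (int k * n)"
proof (induction k)
  case 0
  then show ?case using loc_units_1 by (auto simp: has_order_def)
next
  case (Suc k)
  then show ?case using has_order_mult[of h n "h ^ k" "int k * n"] by (simp add: algebra_simps)
qed

lemma has_order_unit: "h \<in> loc_units \<Longrightarrow> has_order h 0"
  by (auto simp: has_order_def)

lemma has_order_unif: "has_order unif 1"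
  using loc_units_1 by (auto simp: has_order_def)

lemma has_order_nonneg_imp: "has_order h n \<Longrightarrow> n \<ge> 0 \<Longrightarrow> h \<in> loc_ring"
  using loc_ring_mult loc_ring_power unif_in_loc_ring loc_units_subset
  by (auto simp: has_order_def power_int_def)

text \<open>At a branch point \<open>F = (X - a) G\<close> with \<open>G(a) \<noteq> 0\<close>, hence \<open>u - a = v\<^sup>2 / G(u)\<close>.\<close>
lemma has_order_linear: "has_order (ev [:- a, 1:]) (if b = 0 then 2 else 1)"
proof (cases "b = 0")
  case True
  obtain G where G: "F = [:- a, 1:] * G" "\<not> [:- a, 1:] dvd G"
    using order_decomp[OF F_nonzero, of a] smooth[OF True] by auto
  have w: "ev G \<in> loc_units"
    using loc_unitsI[of G 0] G(2) by (simp add: val_def lin_def poly_eq_0_iff_dvd)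
  have "ev [:- a, 1:] = v ^ 2 / ev G"
    using loc_units_nonzero[OF w] by (simp only: v_square G(1) subst_poly_mult) simp
  then show ?thesis
    using has_order_divide[OF has_order_power[OF has_order_unif, of 2] has_order_unit[OF w]]
    by (simp only: unif_ramified[OF True]) (simp add: True)
next
  case False
  then show ?thesis using has_order_unif by (simp add: unif_unramified)
qed

lemma has_order_poly:
  assumes "p \<noteq> 0" shows "has_order (ev p) ((if b = 0 then 2 else 1) * int (order a p))"
proof -
  obtain q where q: "p = [:- a, 1:] ^ order a p * q" "\<not> [:- a, 1:] dvd q"
    using order_decomp[OF assms] by blast
  have "ev q \<in> loc_units"
    using loc_unitsI[of q 0] q(2) by (simp add: val_def lin_def poly_eq_0_iff_dvd)
  moreover have "ev p = ev [:- a, 1:] ^ order a p * ev q"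
    by (subst q(1)) simp
  ultimately show ?thesis
    using has_order_mult[OF has_order_power[OF has_order_linear, of "order a p"] has_order_unit]
    by (simp add: mult.commute)
qed

text \<open>
  The norm \<open>(A + B v)(A - B v) = A\<^sup>2 - B\<^sup>2 F\<close> is a polynomial in \<open>u\<close>, whose order is known. If only one
  of the two factors vanishes at the point, the other one is a unit and the norm gives the order. If
  both vanish, then so do \<open>A(a)\<close> and \<open>B(a)\<close>, as \<open>2b \<noteq> 0\<close>, and a common factor \<open>X - a\<close> can be removed,
  which lowers the degree of the norm by 2.
\<close>
lemma has_order_lin_unramified:
  assumes b: "b \<noteq> 0"
  shows "A ^ 2 - B ^ 2 * F \<noteq> 0 \<Longrightarrow> \<exists>n. has_order (lin A B) (int n)"
proof (induction "degree (A ^ 2 - B ^ 2 * F)" arbitrary: A B rule: less_induct)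
  case less
  define N where "N = A ^ 2 - B ^ 2 * F"
  have N: "lin A B * lin A (- B) = ev N" "N \<noteq> 0" using less.prems by (auto simp: N_def lin_conjugate)
  consider "val A B \<noteq> 0" | "val A B = 0" "val A (- B) \<noteq> 0" | "val A B = 0" "val A (- B) = 0" by blast
  then show ?case
  proof cases
    case 1
    then show ?thesis using has_order_unit[OF loc_unitsI] by (intro exI[of _ 0]) simp
  next
    case 2
    then have w: "lin A (- B) \<in> loc_units" by (intro loc_unitsI)
    then have "lin A B = ev N / lin A (- B)"
      using N(1) loc_units_nonzero by (simp add: field_simps del: lin_eq_0_iff)
    then show ?thesis
      using has_order_divide[OF has_order_poly[OF N(2)] has_order_unit[OF w]] b by auto
  next
    case 3
    then have "val A B + val A (- B) = 0" "val A B - val A (- B) = 0" by simp_all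
    then have "2 * poly A a = 0" "2 * (poly B a * b) = 0" by (simp_all add: val_def algebra_simps)
    then have "poly A a = 0" "poly B a = 0" using two b by auto
    then obtain A' B' where A': "A = [:- a, 1:] * A'" and B': "B = [:- a, 1:] * B'"
      by (auto simp: poly_eq_0_iff_dvd elim!: dvdE)
    have N': "N = [:- a, 1:] ^ 2 * (A' ^ 2 - B' ^ 2 * F)"
      unfolding N_def A' B' by (simp only: power_mult_distrib algebra_simps)
    then have nz: "A' ^ 2 - B' ^ 2 * F \<noteq> 0" using N(2) by auto
    then have "degree N = 2 + degree (A' ^ 2 - B' ^ 2 * F)"
      unfolding N' by (subst degree_mult_eq) (simp_all add: degree_power_eq)
    then obtain n where n: "has_order (lin A' B') (int n)"
      using less.hyps[OF _ nz] by (auto simp: N_def)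
    have "lin A B = ev [:- a, 1:] * lin A' B'" by (simp only: A' B' lin_def subst_poly_mult algebra_simps)
    then show ?thesis using has_order_mult[OF has_order_linear n] b
      by (intro exI[of _ "Suc n"]) simp
  qed
qed

text \<open>
  After division by \<open>unif\<^sup>n\<close> the claim is that a unit plus an element of the maximal ideal is a unit,
  which is seen from its value at the point.
\<close>
lemma has_order_add:
  assumes "has_order h n" "has_order k m" "n < m" shows "has_order (h + k) n"
proof -
  obtain w w' where w: "w \<in> loc_units" "h = unif powi n * w"
    and w': "w' \<in> loc_units" "k = unif powi m * w'"
    using assms by (auto simp: has_order_def)
  obtain A B C D where AB: "w = lin A B / lin C D" "val A B \<noteq> 0" "val C D \<noteq> 0"
    using w by (auto simp: loc_units_def)
  have "unif ^ nat (m - n - 1) * w' \<in> loc_ring"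
    using w' loc_units_subset loc_ring_mult loc_ring_power unif_in_loc_ring by blast
  then obtain A' B' C' D' where A'B': "unif ^ nat (m - n - 1) * w' = lin A' B' / lin C' D'" "val C' D' \<noteq> 0"
    unfolding loc_ring_iff by blast
  obtain T S where T: "unif = lin T S" "val T S = 0" using unif_eq_lin by blast
  \<comment> \<open>With \<open>unif = T + S v\<close>, the pair \<open>(N1 + K1, N2 + K2)\<close> is the numerator of
    \<open>w + unif\<^bsup>m-n\<^esup> w'\<close> over the common denominator; \<open>K\<close> is the part that vanishes at the point.\<close>
  define N1 where "N1 = A * C' + B * D' * F"
  define N2 where "N2 = A * D' + B * C'"
  define M1 where "M1 = A' * C + B' * D * F"
  define M2 where "M2 = A' * D + B' * C"
  define K1 where "K1 = T * M1 + S * M2 * F"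
  define K2 where "K2 = T * M2 + S * M1"
  have nz: "lin C D \<noteq> 0" "lin C' D' \<noteq> 0" using AB A'B' val_nonzero_imp by blast+
  have num: "lin (N1 + K1) (N2 + K2) = lin A B * lin C' D' + unif * (lin A' B' * lin C D)"
    by (simp add: T lin_mult N1_def N2_def M1_def M2_def K1_def K2_def lin_add)
  have "val (N1 + K1) (N2 + K2) = val N1 N2 + val K1 K2" by (simp add: val_def algebra_simps)
  also have "\<dots> = val A B * val C' D'"
    unfolding N1_def N2_def K1_def K2_def val_mult T by simp
  finally have "val (N1 + K1) (N2 + K2) \<noteq> 0" using AB A'B' by simp
  moreover have "w + unif powi (m - n) * w' = lin (N1 + K1) (N2 + K2) / (lin C D * lin C' D')"
  proof -
    have "unif powi (m - n) = unif ^ Suc (nat (m - n - 1))"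
      using assms(3) by (simp add: power_int_def flip: power_Suc) (simp add: nat_diff_distrib Suc_nat_eq_nat_zadd1)
    then have "unif powi (m - n) * w' = unif * (lin A' B' / lin C' D')" by (simp add: flip: A'B'(1))
    then show ?thesis unfolding num AB(1) using nz by (simp add: field_simps del: lin_eq_0_iff)
  qed
  ultimately have "w + unif powi (m - n) * w' \<in> loc_units"
    using AB A'B' by (simp add: loc_unitsI loc_units_divide loc_units_mult)
  moreover have "unif powi m = unif powi n * unif powi (m - n)"
    using power_int_add[of unif n "m - n"] unif_nonzero by simp
  then have "h + k = unif powi n * (w + unif powi (m - n) * w')"
    by (simp only: w(2) w'(2) distrib_left mult.assoc)
  ultimately show ?thesis by (auto simp: has_order_def)
qed

text \<open>
  At a branch point \<open>A\<close> has even and \<open>B v\<close> has odd order, so the two terms never cancel and the order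
  of the sum is the smaller one.
\<close>
lemma has_order_lin_ramified:
  assumes b: "b = 0" and "A \<noteq> 0 \<or> B \<noteq> 0"
  shows "\<exists>n. has_order (lin A B) (int n) \<and> (B \<noteq> 0 \<longrightarrow> n \<le> 2 * order a B + 1)"
proof -
  have A: "has_order (ev A) (int (2 * order a A))" if "A \<noteq> 0"
    using has_order_poly[OF that] b by simp
  have B: "has_order (ev B * v) (int (2 * order a B + 1))" if "B \<noteq> 0"
    using has_order_mult[OF has_order_poly[OF that] has_order_unif] unfolding unif_ramified[OF b]
    by (simp add: b add.commute)
  consider "A = 0" "B \<noteq> 0" | "A \<noteq> 0" "B = 0" | "A \<noteq> 0" "B \<noteq> 0" "2 * order a A < 2 * order a B + 1"
    | "A \<noteq> 0" "B \<noteq> 0" "2 * order a B + 1 < 2 * order a A"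
    using assms(2) by (cases "A = 0"; cases "B = 0"; cases "order a A \<le> order a B") auto
  then show ?thesis
  proof cases
    case 1
    then show ?thesis using B by (intro exI[of _ "2 * order a B + 1"]) (simp add: lin_def)
  next
    case 2
    then show ?thesis using A by (intro exI[of _ "2 * order a A"]) (simp add: lin_def)
  next
    case 3
    then have "has_order (lin A B) (int (2 * order a A))"
      unfolding lin_def using A B by (intro has_order_add) auto
    then show ?thesis using 3 by (intro exI[of _ "2 * order a A"]) simp
  next
    case 4
    then have "has_order (ev B * v + ev A) (int (2 * order a B + 1))"
      using A B by (intro has_order_add) auto
    then show ?thesis by (intro exI[of _ "2 * order a B + 1"]) (simp add: lin_def add.commute)
  qed
qed

lemma has_order_lin: "lin A B \<noteq> 0 \<Longrightarrow> \<exists>n. has_order (lin A B) (int n)"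
  using has_order_lin_ramified has_order_lin_unramified norm_nonzero by (metis lin_eq_0_iff)

lemma has_order_exists:
  assumes "lin A B \<noteq> 0" "C \<noteq> 0" shows "\<exists>n. has_order (lin A B / ev C) n"
  using has_order_lin[OF assms(1)] has_order_poly[OF assms(2)] has_order_divide by metis

lemma uniformizer_unif:
  assumes "local_ring g \<alpha> P = loc_ring"
  shows "uniformizer g \<alpha> P unif"
proof -
  have units: "local_units g \<alpha> P = loc_units"
    by (auto simp: local_units_def assms loc_units_iff)
  have "h \<in> (\<lambda>h. unif * h) ` loc_ring" if h_nonunit: "h \<in> loc_ring" "h \<notin> loc_units" for h
  proof (cases "h = 0")
    case True
    then show ?thesis using h_nonunit(1) by (intro image_eqI[of _ _ 0]) simp_all
  next
    case False
    obtain A B C D where h: "h = lin A B / lin C D" "val C D \<noteq> 0"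
      using h_nonunit(1) unfolding loc_ring_iff by blast
    then obtain n where "has_order (lin A B) (int n)" using False has_order_lin by fastforce
    then obtain w where w: "w \<in> loc_units" "lin A B = unif ^ n * w" by (auto simp: has_order_def)
    have w': "w / lin C D \<in> loc_units" using w h by (simp add: loc_unitsI loc_units_divide)
    have h': "h = unif ^ n * (w / lin C D)" by (simp add: h w)
    with h_nonunit w' obtain m where "n = Suc m" by (cases n) auto
    with h' have "h = unif * (unif ^ m * (w / lin C D))" by simp
    moreover have "unif ^ m * (w / lin C D) \<in> loc_ring"
      using w' loc_units_subset loc_ring_mult loc_ring_power unif_in_loc_ring by blast
    ultimately show ?thesis by blast
  qed
  moreover have "unif * h \<notin> loc_units" if "h \<in> loc_ring" for h
  proof
    assume "unif * h \<in> loc_units"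
    then have "h * inverse (unif * h) \<in> loc_ring" "h \<noteq> 0"
      using that loc_units_iff loc_ring_mult by auto
    then have "inverse unif \<in> loc_ring" by (simp add: field_simps)
    then show False using unif_not_unit loc_units_iff unif_in_loc_ring unif_nonzero by blast
  qed
  ultimately show ?thesis
    unfolding uniformizer_def units assms using unif_in_loc_ring loc_ring_mult by blast
qed

text \<open>
  Two uniformizers generate the same ideal and so differ by a unit; the exponent of \<open>h\<close> is therefore the
  same for all of them.
\<close>
lemma ord_at_eq:
  assumes ring: "local_ring g \<alpha> P = loc_ring" and "has_order h n"
  shows "ord_at g \<alpha> P h = n"
proof -
  have units: "local_units g \<alpha> P = loc_units"
    by (auto simp: local_units_def ring loc_units_iff)
  obtain w where w: "w \<in> loc_units" "h = unif powi n * w" using assms by (auto simp: has_order_def)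
  show ?thesis unfolding ord_at_def units
  proof (rule the_equality)
    show "\<exists>t w. uniformizer g \<alpha> P t \<and> w \<in> loc_units \<and> h = t powi n * w"
      using w uniformizer_unif[OF ring] by blast
  next
    fix m assume "\<exists>t w. uniformizer g \<alpha> P t \<and> w \<in> loc_units \<and> h = t powi m * w"
    then obtain t w' where t: "uniformizer g \<alpha> P t" and w': "w' \<in> loc_units" "h = t powi m * w'" by blast
    have "unif \<in> loc_ring - loc_units" using unif_in_loc_ring unif_not_unit by blast
    then obtain r where r: "r \<in> loc_ring" "unif = t * r"
      using t unfolding uniformizer_def ring units by auto
    have "t \<in> (\<lambda>h. t * h) ` loc_ring"
      using loc_units_1 loc_units_subset by (auto intro!: image_eqI[of _ _ 1])
    then have "t \<in> (\<lambda>h. unif * h) ` loc_ring"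
      using t uniformizer_unif[OF ring] unfolding uniformizer_def ring units by blast
    then obtain r' where r': "r' \<in> loc_ring" "t = unif * r'" by blast
    have "r * r' = 1" using r r' unif_nonzero by (metis mult.assoc mult.commute mult_cancel_left2)
    then have "r' \<in> loc_units" using r r' by (metis inverse_unique loc_units_iff mult.commute mult_zero_right zero_neq_one)
    then have "has_order h m"
      using w' r' loc_units_mult loc_units_powi
      by (auto simp: has_order_def power_int_mult_distrib mult.assoc)
    then show "m = n" using assms has_order_unique by blast
  qed
qed

end


section \<open>The two charts of the hyperelliptic curve\<close>

lemma fun_of_poly_eq_subst: "fun_of_poly p = subst_poly fun_x p"
proof (induction p)
  case (pCons c p)
  have "fun_of_poly (pCons c p) = fun_of_poly ([:c:] + [:0, 1:] * p)" by simp
  also have "\<dots> = fun_of_poly [:c:] + fun_x * subst_poly fun_x p"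
    by (simp only: fun_of_poly_add fun_of_poly_mult fun_x_def[symmetric] pCons.IH)
  finally show ?case by (simp add: subst_poly_pCons)
qed simp

lemma subst_poly_prod: "subst_poly u (\<Prod>i\<in>I. p i) = (\<Prod>i\<in>I. subst_poly u (p i))"
  by (induction I rule: infinite_finite_induct) simp_all

lemma subst_poly_X: "subst_poly u [:0, 1:] = u"
  by (simp add: subst_poly_pCons flip: one_pCons)

text \<open>Reversing the coefficients of a polynomial passes from the coordinate \<open>x\<close> to \<open>1/x\<close>.\<close>
lemma subst_poly_reflect:
  assumes "t \<noteq> 0"
  shows "subst_poly t (reflect_poly p) = t ^ degree p * subst_poly (inverse t) p"
proof -
  let ?c = "\<lambda>c. fun_of_poly [:c:] :: 'a ratfun_closure"
  have c: "?c x = 0 \<longleftrightarrow> x = 0" for x by (simp add: fun_of_poly_eq_0_iff)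
  then have deg: "degree (map_poly ?c p) = degree p" by (intro degree_map_poly) simp
  have "map_poly ?c (reflect_poly p) = reflect_poly (map_poly ?c p)"
    by (intro poly_eqI) (simp add: coeff_map_poly coeff_reflect_poly deg)
  then show ?thesis using assms by (simp add: subst_poly_def poly_reflect_poly_nz deg)
qed

lemma order_eq_1: assumes "poly q a \<noteq> 0" shows "order a ([:- a, 1:] * q) = 1"
proof -
  have "q \<noteq> 0" using assms by auto
  then have "[:- a, 1:] * q \<noteq> 0" by (simp del: mult_pCons_left)
  then have "order a ([:- a, 1:] * q) = order a [:- a, 1:] + order a q" by (rule order_mult)
  then show ?thesis using assms order_power_n_n[of a 1] by (simp add: order_0I)
qed

locale hyperelliptic =
  fixes g :: nat and \<alpha> :: "nat \<Rightarrow> 'a::alg_closed_field"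
  assumes two: "(2::'a) \<noteq> 0"
    and inj: "inj_on \<alpha> {1..2 * g + 1}"
begin

abbreviation f :: "'a poly" where "f \<equiv> hyp_poly g \<alpha>"
abbreviation x :: "'a ratfun_closure" where "x \<equiv> fun_x"
abbreviation y :: "'a ratfun_closure" where "y \<equiv> fun_y g \<alpha>"

text \<open>The polynomial \<open>u\<^bsup>2g+2\<^esup> f(1/u)\<close>, which defines the chart at infinity.\<close>
definition f_inf :: "'a poly" where
  "f_inf = [:0, 1:] * (\<Prod>i = 1..2 * g + 1. [:1, - \<alpha> i:])"

abbreviation u :: "'a ratfun_closure" where "u \<equiv> 1 / fun_x"
abbreviation w :: "'a ratfun_closure" where "w \<equiv> fun_y g \<alpha> / fun_x ^ (g + 1)"

lemma x_nonzero: "x \<noteq> 0"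
  by (simp add: fun_x_def fun_of_poly_eq_0_iff)

lemma y_square: "y ^ 2 = subst_poly x f"
proof -
  have "\<exists>y. y ^ 2 = fun_of_poly f" by (rule nth_root_exists) simp
  then show ?thesis unfolding fun_y_def fun_of_poly_eq_subst[symmetric] by (rule someI_ex)
qed

lemma poly_f_eq_0_iff: "poly f a = 0 \<longleftrightarrow> (\<exists>i \<in> {1..2 * g + 1}. a = \<alpha> i)"
  unfolding hyp_poly_def by (auto simp: poly_prod prod_zero_iff simp del: prod.cl_ivl_Suc)

lemma order_f: assumes "poly f a = 0" shows "order a f = 1"
proof -
  obtain i where i: "i \<in> {1..2 * g + 1}" "a = \<alpha> i" using assms poly_f_eq_0_iff by blast
  have "f = [:- a, 1:] * (\<Prod>j \<in> {1..2 * g + 1} - {i}. [:- \<alpha> j, 1:])"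
    unfolding hyp_poly_def using i by (subst prod.remove[of _ i]) auto
  moreover have "poly (\<Prod>j \<in> {1..2 * g + 1} - {i}. [:- \<alpha> j, 1:]) a \<noteq> 0"
    using i inj by (auto simp: poly_prod prod_zero_iff inj_on_def)
  ultimately show ?thesis using order_eq_1 by metis
qed

lemma order_f_inf: "order 0 f_inf = 1"
  using order_eq_1[of "\<Prod>i = 1..2 * g + 1. [:1, - \<alpha> i:]" 0]
  by (simp add: f_inf_def poly_prod prod_zero_iff)

lemma f_inf_nonzero: "f_inf \<noteq> 0"
  by (simp add: f_inf_def prod_zero_iff del: prod.cl_ivl_Suc mult_pCons_left)

lemma w_square: "w ^ 2 = subst_poly u f_inf"
proof -
  have "subst_poly u f_inf = u * (\<Prod>i = 1..2 * g + 1. subst_poly u [:1, - \<alpha> i:])"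
    by (simp only: f_inf_def subst_poly_mult subst_poly_prod subst_poly_X)
  also have "(\<Prod>i = 1..2 * g + 1. subst_poly u [:1, - \<alpha> i:]) = (\<Prod>i = 1..2 * g + 1. subst_poly x [:- \<alpha> i, 1:] / x)"
    by (intro prod.cong refl)
      (simp add: subst_poly_pCons x_nonzero field_simps flip: one_pCons)
  also have "\<dots> = y ^ 2 / x ^ (2 * g + 1)"
    unfolding prod_dividef by (simp add: y_square hyp_poly_def subst_poly_prod del: prod.cl_ivl_Suc)
  also have "u * (y ^ 2 / x ^ (2 * g + 1)) = w ^ 2"
    by (simp add: power_divide power_mult_distrib flip: power_mult)
       (simp add: power2_eq_square power_mult mult_ac)
  finally show ?thesis ..
qed

sublocale aff: double_cover f x y
proof
  show "\<exists>c. odd (order c f)"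
    by (rule exI[of _ "\<alpha> 1"]) (subst order_f, auto simp: poly_f_eq_0_iff)
  show "f \<noteq> 0" by (simp add: hyp_poly_def prod_zero_iff del: prod.cl_ivl_Suc)
qed (auto simp: two y_square fun_of_poly_eq_0_iff simp flip: fun_of_poly_eq_subst)

sublocale inf: smooth_point f_inf u w 0 0
proof
  fix p :: "'a poly" assume "subst_poly u p = 0"
  then have "subst_poly x (reflect_poly p) = 0"
    by (simp add: subst_poly_reflect x_nonzero inverse_eq_divide)
  then show "p = 0" by (simp del: aff.lin_eq_0_iff)
next
  show "\<exists>c. odd (order c f_inf)" by (rule exI[of _ 0]) (simp add: order_f_inf)
next
  show "w ^ 2 = subst_poly u f_inf" by (rule w_square)
  show "0 ^ 2 = poly f_inf 0" by (simp add: f_inf_def)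
qed (simp_all add: two f_inf_nonzero order_f_inf)

lemma smooth_point_aff: "Aff a b \<in> hcurve g \<alpha> \<Longrightarrow> smooth_point f x y a b"
  by unfold_locales (auto simp: hcurve_def order_f)

section \<open>The function field\<close>

lemma function_field_eq: "function_field g \<alpha> = {aff.lin A B / aff.ev C | A B C. C \<noteq> 0}"
proof -
  have frac: "to_ac (Fraction_Field.Fract p q) = aff.ev p / aff.ev q" if "q \<noteq> 0" for p q :: "'a poly"
  proof -
    have "Fraction_Field.Fract p q = Fraction_Field.Fract p 1 / Fraction_Field.Fract q 1"
      using that by simp
    then show ?thesis by (simp only: fun_of_poly_def to_ac_divide flip: fun_of_poly_eq_subst)
  qed
  show ?thesis
  proof (intro equalityI subsetI)
    fix h assume "h \<in> function_field g \<alpha>"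
    then obtain r s where h: "h = to_ac r + to_ac s * y" by (auto simp: function_field_def)
    obtain p q where r: "r = Fraction_Field.Fract p q" "q \<noteq> 0" by (cases r) auto
    obtain p' q' where s: "s = Fraction_Field.Fract p' q'" "q' \<noteq> 0" by (cases s) auto
    have "h = aff.lin (p * q') (p' * q) / aff.ev (q * q')"
      using r s by (simp add: h frac aff.lin_def field_simps)
    moreover have "q * q' \<noteq> 0" using r s by simp
    ultimately show "h \<in> {aff.lin A B / aff.ev C | A B C. C \<noteq> 0}" by blast
  next
    fix h assume "h \<in> {aff.lin A B / aff.ev C | A B C. C \<noteq> 0}"
    then obtain A B C where h: "h = aff.lin A B / aff.ev C" "C \<noteq> 0" by blast
    then have "h = to_ac (Fraction_Field.Fract A C) + to_ac (Fraction_Field.Fract B C) * y"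
      by (simp add: frac aff.lin_def add_divide_distrib)
    then show "h \<in> function_field g \<alpha>" unfolding function_field_def by blast
  qed
qed

lemma function_field_cases:
  assumes "h \<in> function_field g \<alpha>" obtains A B C where "h = aff.lin A B / aff.ev C" "C \<noteq> 0"
  using assms function_field_eq by auto

lemma function_fieldI: "C \<noteq> 0 \<Longrightarrow> aff.lin A B / aff.ev C \<in> function_field g \<alpha>"
  using function_field_eq by auto

lemma ev_in_function_field: "aff.ev p \<in> function_field g \<alpha>"
  using function_fieldI[of 1 p 0] by (simp add: aff.lin_0_right)

lemma function_field_mult:
  assumes "h \<in> function_field g \<alpha>" "k \<in> function_field g \<alpha>"
  shows "h * k \<in> function_field g \<alpha>"
proof -
  obtain A B C where h: "h = aff.lin A B / aff.ev C" "C \<noteq> 0" using assms(1) by (rule function_field_cases)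
  obtain A' B' C' where k: "k = aff.lin A' B' / aff.ev C'" "C' \<noteq> 0" using assms(2) by (rule function_field_cases)
  have "h * k = aff.lin A B * aff.lin A' B' / aff.ev (C * C')" by (simp add: h k)
  moreover have "C * C' \<noteq> 0" using h k by simp
  ultimately show ?thesis unfolding aff.lin_mult using function_fieldI by metis
qed

lemma function_field_inverse:
  assumes "h \<in> function_field g \<alpha>"
  shows "inverse h \<in> function_field g \<alpha>"
proof (cases "h = 0")
  case True
  then show ?thesis using assms by simp
next
  case False
  obtain A B C where h: "h = aff.lin A B / aff.ev C" "C \<noteq> 0" using assms(1) by (rule function_field_cases)
  define N where "N = A ^ 2 - B ^ 2 * f"
  have nz: "aff.lin A B \<noteq> 0" using False h by (auto simp del: aff.lin_eq_0_iff)
  then have N: "N \<noteq> 0" unfolding N_def by (rule aff.norm_nonzero)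
  have conj: "aff.lin A B * aff.lin A (- B) = aff.ev N" by (simp add: N_def aff.lin_conjugate)
  then have "inverse (aff.lin A B) = aff.lin A (- B) / aff.ev N"
    using nz N by (simp add: field_simps del: aff.lin_eq_0_iff)
  moreover have "inverse h = aff.ev C * inverse (aff.lin A B)" by (simp add: h divide_inverse del: aff.lin_eq_0_iff)
  moreover have "aff.ev C * aff.lin A (- B) = aff.lin (C * A) (- (C * B))"
    by (simp add: aff.lin_def algebra_simps)
  ultimately have "inverse h = aff.lin (C * A) (- (C * B)) / aff.ev N"
    by simp
  then show ?thesis using N function_fieldI by simp
qed

section \<open>Orders at infinity\<close>

lemma ev_at_infinity: "aff.ev p * u ^ degree p = inf.ev (reflect_poly p)"
  using subst_poly_reflect[of u p] x_nonzero by (simp add: mult.commute)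

text \<open>
  A function without affine poles, rewritten in the chart at infinity. The exponent is large enough to
  clear the poles of both \<open>A(x)\<close> and \<open>B(x) y = B(x) w x\<^bsup>g+1\<^esup>\<close>.
\<close>
lemma lin_at_infinity:
  "aff.lin A B * u ^ (degree A + degree B + g + 1) =
   inf.lin (monom 1 (degree B + g + 1) * reflect_poly A) (monom 1 (degree A) * reflect_poly B)"
proof -
  have monom: "inf.ev (monom 1 n) = u ^ n" for n
    by (simp only: monom_altdef smult_1_left subst_poly_power subst_poly_X)
  have y: "y * u ^ (g + 1) = w" by (simp add: power_divide)
  have "aff.lin A B * u ^ (degree A + degree B + g + 1) =
    u ^ (degree B + g + 1) * (aff.ev A * u ^ degree A) +
    u ^ degree A * (aff.ev B * u ^ degree B) * (y * u ^ (g + 1))"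
    by (simp only: aff.lin_def power_add distrib_left distrib_right mult_ac)
  then show ?thesis
    unfolding ev_at_infinity y by (simp only: inf.lin_def monom subst_poly_mult)
qed

lemma reflect_poly_order: "p \<noteq> 0 \<Longrightarrow> order 0 (reflect_poly p) = 0"
  by (simp add: order_0I)

lemma inf_has_order_u: "inf.has_order u 2"
  using inf.has_order_linear by (simp add: subst_poly_X)

lemma inf_has_order_ev:
  assumes "p \<noteq> 0" shows "inf.has_order (aff.ev p) (- 2 * int (degree p))"
proof -
  have "inf.has_order (aff.ev p * u ^ degree p) 0"
    using inf.has_order_poly[of "reflect_poly p"] assms
    by (simp add: ev_at_infinity reflect_poly_order)
  from inf.has_order_divide[OF this inf.has_order_power[OF inf_has_order_u, of "degree p"]]
  show ?thesis using x_nonzero by (simp add: mult.commute)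
qed

text \<open>
  The pole of \<open>B(x) y\<close> at infinity has order \<open>2 deg B + 2g + 1\<close>, which is odd and so is not cancelled
  by the pole of \<open>A(x)\<close>: a function with nonzero \<open>y\<close>-part has a pole of order more than \<open>2g\<close>.
\<close>
lemma inf_has_order_lin:
  assumes "A \<noteq> 0 \<or> B \<noteq> 0"
  shows "\<exists>n. inf.has_order (aff.lin A B) n \<and> (B \<noteq> 0 \<longrightarrow> n < - 2 * int g)"
proof -
  define N where "N = degree A + degree B + g + 1"
  define A' where "A' = monom 1 (degree B + g + 1) * reflect_poly A"
  define B' where "B' = monom 1 (degree A) * reflect_poly B"
  have lin: "aff.lin A B * u ^ N = inf.lin A' B'"
    unfolding N_def A'_def B'_def by (rule lin_at_infinity)
  have "A' \<noteq> 0 \<or> B' \<noteq> 0" using assms by (simp add: A'_def B'_def)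
  then obtain n where n: "inf.has_order (inf.lin A' B') (int n)" "B' \<noteq> 0 \<longrightarrow> n \<le> 2 * order 0 B' + 1"
    using inf.has_order_lin_ramified by blast
  have "B' \<noteq> 0 \<and> order 0 B' = degree A" if "B \<noteq> 0"
  proof -
    have nz: "B' \<noteq> 0" using that by (simp add: B'_def)
    then have "order 0 B' = order 0 (monom (1::'a) (degree A)) + order 0 (reflect_poly B)"
      unfolding B'_def by (rule order_mult)
    then show ?thesis using nz that by (simp add: reflect_poly_order)
  qed
  then have "B \<noteq> 0 \<longrightarrow> int n - int N * 2 < - 2 * int g" using n(2) by (auto simp: N_def)
  moreover have "inf.has_order (aff.lin A B) (int n - int N * 2)"
    using inf.has_order_divide[OF n(1) inf.has_order_power[OF inf_has_order_u, of N]] x_nonzero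
    unfolding lin[symmetric] by simp
  ultimately show ?thesis by blast
qed

section \<open>Orders at all points\<close>

fun has_order_at :: "'a hpoint \<Rightarrow> 'a ratfun_closure \<Rightarrow> int \<Rightarrow> bool" where
  "has_order_at (Aff a b) = smooth_point.has_order x y a b"
| "has_order_at Infty = inf.has_order"

lemma has_order_at_exists:
  assumes "P \<in> hcurve g \<alpha>" "h \<in> function_field g \<alpha> - {0}"
  shows "\<exists>n. has_order_at P h n"
proof -
  obtain A B C where h: "h = aff.lin A B / aff.ev C" "C \<noteq> 0"
    using assms(2) function_field_cases by blast
  then have AB: "aff.lin A B \<noteq> 0" using assms(2) by (auto simp del: aff.lin_eq_0_iff)
  show ?thesis
  proof (cases P)
    case (Aff a b)
    then interpret smooth_point f x y a b using assms smooth_point_aff by blast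
    show ?thesis using has_order_exists[OF AB h(2)] by (simp add: Aff h)
  next
    case Infty
    obtain n where "inf.has_order (aff.lin A B) n" using inf_has_order_lin AB by auto
    then show ?thesis using inf.has_order_divide inf_has_order_ev[OF h(2)] Infty h by fastforce
  qed
qed

lemma ord_at_eqI:
  assumes "P \<in> hcurve g \<alpha>" "has_order_at P h n"
  shows "ord_at g \<alpha> P h = n"
proof (cases P)
  case (Aff a b)
  then interpret smooth_point f x y a b using assms smooth_point_aff by blast
  show ?thesis using assms Aff by (intro ord_at_eq) auto
next
  case Infty
  then show ?thesis using assms by (intro inf.ord_at_eq) auto
qed

lemma has_order_at_ord_at:
  assumes "P \<in> hcurve g \<alpha>" "h \<in> function_field g \<alpha> - {0}"
  shows "has_order_at P h (ord_at g \<alpha> P h)"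
  using has_order_at_exists[OF assms] ord_at_eqI[OF assms(1)] by auto

lemma ord_at_mult:
  assumes "P \<in> hcurve g \<alpha>" "h \<in> function_field g \<alpha> - {0}" "k \<in> function_field g \<alpha> - {0}"
  shows "ord_at g \<alpha> P (h * k) = ord_at g \<alpha> P h + ord_at g \<alpha> P k"
proof (rule ord_at_eqI[OF assms(1)], cases P)
  case (Aff a b)
  then interpret smooth_point f x y a b using assms smooth_point_aff by blast
  show "has_order_at P (h * k) (ord_at g \<alpha> P h + ord_at g \<alpha> P k)"
    using has_order_at_ord_at[OF assms(1,2)] has_order_at_ord_at[OF assms(1,3)] Aff has_order_mult by simp
next
  case Infty
  then show "has_order_at P (h * k) (ord_at g \<alpha> P h + ord_at g \<alpha> P k)"
    using has_order_at_ord_at[OF assms(1,2)] has_order_at_ord_at[OF assms(1,3)] inf.has_order_mult by simp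
qed

lemma ord_at_inverse:
  assumes "P \<in> hcurve g \<alpha>" "h \<in> function_field g \<alpha> - {0}"
  shows "ord_at g \<alpha> P (inverse h) = - ord_at g \<alpha> P h"
proof (rule ord_at_eqI[OF assms(1)], cases P)
  case (Aff a b)
  then interpret smooth_point f x y a b using assms smooth_point_aff by blast
  show "has_order_at P (inverse h) (- ord_at g \<alpha> P h)"
    using has_order_at_ord_at[OF assms] Aff has_order_inverse by simp
next
  case Infty
  then show "has_order_at P (inverse h) (- ord_at g \<alpha> P h)"
    using has_order_at_ord_at[OF assms] inf.has_order_inverse by simp
qed

lemma ord_at_ev_aff:
  assumes "Aff a b \<in> hcurve g \<alpha>" "p \<noteq> 0"
  shows "ord_at g \<alpha> (Aff a b) (aff.ev p) = (if b = 0 then 2 else 1) * int (order a p)"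
proof -
  interpret smooth_point f x y a b using assms smooth_point_aff by blast
  show ?thesis using assms has_order_poly by (intro ord_at_eqI) auto
qed

lemma ord_at_ev_inf:
  assumes "p \<noteq> 0" shows "ord_at g \<alpha> Infty (aff.ev p) = - 2 * int (degree p)"
  using inf_has_order_ev[OF assms] by (intro ord_at_eqI) (auto simp: hcurve_def)

section \<open>Functions with a small pole at infinity\<close>

lemma curve_point_exists: obtains b where "Aff a b \<in> hcurve g \<alpha>" "Aff a (- b) \<in> hcurve g \<alpha>"
proof -
  obtain b where "b ^ 2 = poly f a" using nth_root_exists[of 2 "poly f a"] by auto
  then show ?thesis using that by (auto simp: hcurve_def)
qed

text \<open>
  A function that is regular at all affine points lies in \<open>K[x, y]\<close>. If the denominator \<open>C\<close> has a
  root \<open>a\<close>, then \<open>A + B y\<close> vanishes at both points over \<open>a\<close> (or doubly at the single point, if \<open>a\<close> is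
  a branch point); so \<open>X - a\<close> divides both \<open>A\<close> and \<open>B\<close> and can be cancelled.
\<close>
lemma regular_imp_lin:
  assumes "\<And>a b. Aff a b \<in> hcurve g \<alpha> \<Longrightarrow> aff.lin A B / aff.ev C \<in> plane_local_ring x y a b"
    and "C \<noteq> 0"
  shows "\<exists>A' B'. aff.lin A B / aff.ev C = aff.lin A' B'"
  using assms
proof (induction "degree C" arbitrary: A B C rule: less_induct)
  case less
  show ?case
  proof (cases "degree C = 0")
    case True
    then obtain c where c: "C = [:c:]" "c \<noteq> 0" using less.prems(2) by (metis degree_eq_zeroE pCons_0_0)
    have "aff.ev C * aff.ev [:inverse c:] = 1" using c by (simp flip: subst_poly_mult one_pCons)
    then have "inverse (aff.ev C) = aff.ev [:inverse c:]" by (rule inverse_unique)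
    then have "aff.lin A B / aff.ev C = aff.lin (A * [:inverse c:]) (B * [:inverse c:])"
      by (simp add: aff.lin_def divide_inverse algebra_simps del: mult_pCons_right)
    then show ?thesis by blast
  next
    case False
    then obtain a where a: "poly C a = 0" using alg_closed_imp_poly_has_root by blast
    then obtain C' where C': "C = [:- a, 1:] * C'" by (auto simp: poly_eq_0_iff_dvd elim!: dvdE)
    have val0: "poly A a + poly B a * b = 0" if P: "Aff a b \<in> hcurve g \<alpha>" for b
    proof -
      interpret smooth_point f x y a b using P by (rule smooth_point_aff)
      obtain A' B' C' D' where 1: "aff.lin A B * aff.lin C' D' = aff.lin A' B' * aff.lin C 0" "val C' D' \<noteq> 0"
        using loc_ring_cross_mult[OF less.prems(1)[OF P] less.prems(2)] by blast
      from 1(1) have "val A B * val C' D' = val A' B' * val C 0"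
        by (simp add: aff.lin_mult aff.lin_eq_iff flip: val_mult)
      then show ?thesis using 1(2) a by (simp add: val_def)
    qed
    obtain b where b: "Aff a b \<in> hcurve g \<alpha>" "Aff a (- b) \<in> hcurve g \<alpha>" by (rule curve_point_exists)
    have "poly A a = 0 \<and> poly B a = 0"
    proof (cases "b = 0")
      case False
      have "2 * poly A a = 0" "2 * (poly B a * b) = 0"
        using val0[OF b(1)] val0[OF b(2)] by (simp_all add: algebra_simps add_eq_0_iff)
      then show ?thesis using two False by simp
    next
      case True
      then have "poly A a = 0" using val0[OF b(1)] by simp
      interpret smooth_point f x y a b using b(1) by (rule smooth_point_aff)
      obtain A' B' C1 D1 where 1: "aff.lin A B * aff.lin C1 D1 = aff.lin A' B' * aff.lin C 0" "val C1 D1 \<noteq> 0"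
        using loc_ring_cross_mult[OF less.prems(1)[OF b(1)] less.prems(2)] by blast
      \<comment> \<open>The values at the branch point only give \<open>A(a) = 0\<close>; the coefficients of \<open>y\<close> on both
        sides give \<open>B(a) = 0\<close>, because \<open>C1(a)\<close> is the nonzero value of the denominator there.\<close>
      from 1(1) have "A * D1 + B * C1 = B' * C"
        by (simp add: aff.lin_mult aff.lin_eq_iff)
      then have "poly A a * poly D1 a + poly B a * poly C1 a = poly B' a * poly C a"
        by (metis poly_add poly_mult)
      moreover have "poly C1 a \<noteq> 0" using 1(2)[unfolded val_def] True by simp
      ultimately show ?thesis using \<open>poly A a = 0\<close> a by simp
    qed
    then obtain A' B' where A'B': "A = [:- a, 1:] * A'" "B = [:- a, 1:] * B'"
      by (auto simp: poly_eq_0_iff_dvd elim!: dvdE)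
    have "aff.lin A B = aff.ev [:- a, 1:] * aff.lin A' B'"
      by (simp only: A'B' aff.lin_def subst_poly_mult algebra_simps)
    then have eq: "aff.lin A B / aff.ev C = aff.lin A' B' / aff.ev C'"
      by (simp only: C' subst_poly_mult) simp
    have nz: "C' \<noteq> 0" using C' less.prems(2) by auto
    then have "degree C' < degree C" unfolding C' by (subst degree_mult_eq) auto
    then show ?thesis using less.hyps[of C' A' B'] less.prems(1) nz unfolding eq by blast
  qed
qed

text \<open>
  The space \<open>L(2g (\<infinity>))\<close> consists of polynomials in \<open>x\<close>, since \<open>y\<close> has a pole of order \<open>2g + 1\<close>.
\<close>
lemma low_pole_imp_polynomial:
  assumes h: "h \<in> function_field g \<alpha> - {0}"
    and reg: "\<And>a b. Aff a b \<in> hcurve g \<alpha> \<Longrightarrow> ord_at g \<alpha> (Aff a b) h \<ge> 0"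
    and pole: "ord_at g \<alpha> Infty h \<ge> - 2 * int g"
  shows "\<exists>p. p \<noteq> 0 \<and> h = aff.ev p"
proof -
  obtain A B C where ABC: "h = aff.lin A B / aff.ev C" "C \<noteq> 0"
    using h function_field_cases by blast
  have "h \<in> plane_local_ring x y a b" if "Aff a b \<in> hcurve g \<alpha>" for a b
  proof -
    interpret smooth_point f x y a b using that by (rule smooth_point_aff)
    show ?thesis using has_order_nonneg_imp has_order_at_ord_at[OF that h] reg[OF that] by simp
  qed
  then obtain A' B' where h': "h = aff.lin A' B'" using regular_imp_lin ABC by metis
  then have "A' \<noteq> 0 \<or> B' \<noteq> 0" using h by auto
  then obtain n where n: "inf.has_order h n" "B' \<noteq> 0 \<longrightarrow> n < - 2 * int g"
    using inf_has_order_lin h' by blast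
  then have "ord_at g \<alpha> Infty h = n" by (intro ord_at_eqI) (auto simp: hcurve_def)
  then have "B' = 0" using n pole by auto
  then show ?thesis using h h' by (auto simp: aff.lin_0_right)
qed

end


section \<open>Degrees of divisors\<close>

lemma order_linear: "order c [:- a, 1:] = (if c = a then 1 else 0)" for a c :: "'a::field"
  using order_power_n_n[of a 1] by (auto intro: order_0I)

text \<open>
  The supports of the two divisors may overlap and cancel in the sum, so all three degrees are computed
  over the union of the supports.
\<close>
lemma div_degree_add: "div_degree (D + E) = div_degree D + div_degree E"
proof -
  have sum: "div_degree D' = (\<Sum>P \<in> Poly_Mapping.keys D \<union> Poly_Mapping.keys E. Poly_Mapping.lookup D' P)"
    if "Poly_Mapping.keys D' \<subseteq> Poly_Mapping.keys D \<union> Poly_Mapping.keys E" for D'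
    unfolding div_degree_def using that
    by (intro sum.mono_neutral_left) (auto simp: in_keys_iff)
  show ?thesis
    by (simp add: sum Poly_Mapping.keys_add lookup_add sum.distrib)
qed

lemma div_degree_embed: "div_degree (frag_of P - frag_of Infty) = 0"
proof -
  have "div_degree (frag_of R) = 1" for R :: "'a hpoint"
    by (simp add: div_degree_def keys_frag_of)
  then show ?thesis
    using div_degree_add[of "frag_of P - frag_of Infty" "frag_of Infty"] by simp
qed

lemma div_degree_0: "div_degree 0 = 0"
  by (simp add: div_degree_def)

section \<open>The group law on divisor classes\<close>

context hyperelliptic
begin

abbreviation Div where "Div \<equiv> divisor_group g \<alpha>"
abbreviation Prin where "Prin \<equiv> principal_divisors g \<alpha>"
abbreviation Jac where "Jac \<equiv> jacobian g \<alpha>"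

lemma Infty_on_curve: "Infty \<in> hcurve g \<alpha>"
  by (simp add: hcurve_def)

lemma principalE:
  assumes "D \<in> Prin"
  obtains h where "h \<in> function_field g \<alpha> - {0}"
    "\<And>P. P \<in> hcurve g \<alpha> \<Longrightarrow> Poly_Mapping.lookup D P = ord_at g \<alpha> P h"
  using assms by (auto simp: principal_divisors_def)

lemma principalI:
  assumes "D \<in> carrier Div" "h \<in> function_field g \<alpha> - {0}"
    "\<And>P. P \<in> hcurve g \<alpha> \<Longrightarrow> Poly_Mapping.lookup D P = ord_at g \<alpha> P h"
  shows "D \<in> Prin"
  using assms by (auto simp: principal_divisors_def)

lemma principal_subgroup: "subgroup Prin Div"
proof (rule group.subgroupI[OF group_free_Abelian_group])
  show "Prin \<subseteq> carrier Div" by (auto simp: principal_divisors_def)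
  have one: "aff.ev 1 \<in> function_field g \<alpha> - {0}" using ev_in_function_field[of 1] by simp
  have "0 \<in> Prin"
  proof (rule principalI[OF _ one])
    fix P assume "P \<in> hcurve g \<alpha>"
    then show "Poly_Mapping.lookup 0 P = ord_at g \<alpha> P (aff.ev 1)"
      using ord_at_mult[OF _ one one] by simp
  qed simp
  then show "Prin \<noteq> {}" by blast
  fix D assume D: "D \<in> Prin"
  obtain h where h: "h \<in> function_field g \<alpha> - {0}"
    "\<And>P. P \<in> hcurve g \<alpha> \<Longrightarrow> Poly_Mapping.lookup D P = ord_at g \<alpha> P h"
    using D by (rule principalE) blast
  have keys: "D \<in> carrier Div" using D by (auto simp: principal_divisors_def)
  have "- D \<in> Prin"
    using h ord_at_inverse keys by (intro principalI[of _ "inverse h"]) (auto intro: function_field_inverse)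
  then show "inv\<^bsub>Div\<^esub> D \<in> Prin" using keys by simp
  fix E assume E: "E \<in> Prin"
  obtain k where k: "k \<in> function_field g \<alpha> - {0}"
    "\<And>P. P \<in> hcurve g \<alpha> \<Longrightarrow> Poly_Mapping.lookup E P = ord_at g \<alpha> P k"
    using E by (rule principalE) blast
  have "E \<in> carrier Div" using E by (auto simp: principal_divisors_def)
  with keys have "D + E \<in> carrier Div" using keys_add[of D E] by auto
  then have "D + E \<in> Prin"
    using h k ord_at_mult
    by (intro principalI[of _ "h * k"]) (auto intro: function_field_mult simp: lookup_add)
  then show "D \<otimes>\<^bsub>Div\<^esub> E \<in> Prin" by simp
qed

sublocale prin: normal Prin Div
  using comm_group.subgroup_imp_normal[OF abelian_free_Abelian_group principal_subgroup] .

lemma jacobian_simps: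
  "carrier Jac = cl g \<alpha> ` {D \<in> carrier Div. div_degree D = 0}"
  "\<one>\<^bsub>Jac\<^esub> = Prin" "z \<otimes>\<^bsub>Jac\<^esub> z' = z <#>\<^bsub>Div\<^esub> z'"
  by (simp_all add: jacobian_def picard_group_def FactGroup_def)

lemma cl_mult: "D \<in> carrier Div \<Longrightarrow> E \<in> carrier Div \<Longrightarrow> cl g \<alpha> D \<otimes>\<^bsub>Jac\<^esub> cl g \<alpha> E = cl g \<alpha> (D + E)"
  unfolding jacobian_simps cl_def using prin.rcos_sum[of D E] by simp

lemma cl_0: "cl g \<alpha> 0 = \<one>\<^bsub>Jac\<^esub>"
  unfolding jacobian_simps cl_def
  using prin.coset_mult_one[of Prin] prin.subset by simp

lemma cl_eq_iff:
  assumes "D \<in> carrier Div" "E \<in> carrier Div"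
  shows "cl g \<alpha> D = cl g \<alpha> E \<longleftrightarrow> D - E \<in> Prin"
proof -
  have mem: "D \<in> cl g \<alpha> E \<longleftrightarrow> D - E \<in> Prin"
    by (auto simp: cl_def r_coset_def intro: bexI[of _ "D - E"])
  show ?thesis
  proof
    assume "cl g \<alpha> D = cl g \<alpha> E"
    moreover have "D \<in> cl g \<alpha> D"
      unfolding cl_def using assms prin.rcos_self principal_subgroup by blast
    ultimately show "D - E \<in> Prin" using mem by simp
  next
    assume "D - E \<in> Prin"
    then have "D \<in> Prin #>\<^bsub>Div\<^esub> E" using mem by (simp add: cl_def)
    then show "cl g \<alpha> D = cl g \<alpha> E"
      unfolding cl_def using prin.repr_independence assms principal_subgroup by metis
  qed
qed

lemma Div_add: "D \<in> carrier Div \<Longrightarrow> E \<in> carrier Div \<Longrightarrow> D + E \<in> carrier Div"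
  using prin.m_closed[of D E] by simp

lemma comm_monoid_jacobian: "comm_monoid Jac"
proof (rule comm_monoidI)
  fix z1 z2 z3 assume "z1 \<in> carrier Jac" "z2 \<in> carrier Jac"
  then obtain D E where DE: "z1 = cl g \<alpha> D" "D \<in> carrier Div" "div_degree D = 0"
      "z2 = cl g \<alpha> E" "E \<in> carrier Div" "div_degree E = 0"
    unfolding jacobian_simps by blast
  then show "z1 \<otimes>\<^bsub>Jac\<^esub> z2 \<in> carrier Jac"
    using cl_mult Div_add unfolding jacobian_simps(1) by (auto simp: div_degree_add simp del: carrier_free_Abelian_group_iff)
  show "z1 \<otimes>\<^bsub>Jac\<^esub> z2 = z2 \<otimes>\<^bsub>Jac\<^esub> z1"
    using DE by (simp add: cl_mult add.commute)
  show "\<one>\<^bsub>Jac\<^esub> \<otimes>\<^bsub>Jac\<^esub> z1 = z1"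
    using DE by (simp add: cl_mult flip: cl_0)
  assume "z3 \<in> carrier Jac"
  then obtain F where "z3 = cl g \<alpha> F" "F \<in> carrier Div" unfolding jacobian_simps by blast
  then show "z1 \<otimes>\<^bsub>Jac\<^esub> z2 \<otimes>\<^bsub>Jac\<^esub> z3 = z1 \<otimes>\<^bsub>Jac\<^esub> (z2 \<otimes>\<^bsub>Jac\<^esub> z3)"
    using DE Div_add by (simp add: cl_mult add.assoc del: carrier_free_Abelian_group_iff)
next
  show "\<one>\<^bsub>Jac\<^esub> \<in> carrier Jac"
    unfolding cl_0[symmetric] jacobian_simps(1) by (auto simp: div_degree_0)
qed

lemma square_cl: "D \<in> carrier Div \<Longrightarrow> div_degree D = 0 \<Longrightarrow> cl g \<alpha> D [^]\<^bsub>Jac\<^esub> (2::nat) = cl g \<alpha> (D + D)"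
proof -
  interpret comm_monoid Jac by (rule comm_monoid_jacobian)
  assume D: "D \<in> carrier Div" "div_degree D = 0"
  then have "cl g \<alpha> D \<in> carrier Jac" by (auto simp: jacobian_simps(1))
  then show ?thesis using D by (simp add: numeral_2_eq_2 cl_mult)
qed

lemma embed_in_Div: "P \<in> hcurve g \<alpha> \<Longrightarrow> frag_of P - frag_of Infty \<in> carrier Div"
  using keys_diff[of "frag_of P" "frag_of Infty"] Infty_on_curve by (auto simp: keys_frag_of)

lemma finprod_embed:
  fixes Q :: "nat \<Rightarrow> 'a hpoint"
  assumes "finite I" "Q \<in> I \<rightarrow> hcurve g \<alpha>"
  shows "finprod Jac (\<lambda>i. jac_embed g \<alpha> (Q i)) I = cl g \<alpha> (\<Sum>i\<in>I. frag_of (Q i) - frag_of Infty) \<and>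
    (\<Sum>i\<in>I. frag_of (Q i) - frag_of Infty) \<in> carrier Div \<and>
    div_degree (\<Sum>i\<in>I. frag_of (Q i) - frag_of Infty) = 0"
  using assms
proof (induction I rule: finite_induct)
  case empty
  interpret comm_monoid Jac by (rule comm_monoid_jacobian)
  show ?case by (simp add: cl_0 div_degree_0)
next
  case (insert i I)
  interpret comm_monoid Jac by (rule comm_monoid_jacobian)
  have Q: "Q \<in> I \<rightarrow> hcurve g \<alpha>" "Q i \<in> hcurve g \<alpha>" using insert.prems by auto
  note IH = insert.IH[OF Q(1)]
  have emb: "jac_embed g \<alpha> P \<in> carrier Jac" if "P \<in> hcurve g \<alpha>" for P
    unfolding jac_embed_def jacobian_simps(1) using that embed_in_Div div_degree_embed by blast
  have "finprod Jac (\<lambda>i. jac_embed g \<alpha> (Q i)) (insert i I) =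
      jac_embed g \<alpha> (Q i) \<otimes>\<^bsub>Jac\<^esub> finprod Jac (\<lambda>i. jac_embed g \<alpha> (Q i)) I"
    using insert.hyps Q emb by (intro finprod_insert) auto
  then show ?case
    using IH Q insert.hyps embed_in_Div Div_add
    by (simp add: jac_embed_def cl_mult div_degree_add div_degree_embed del: carrier_free_Abelian_group_iff)
qed

section \<open>Doubled divisors and Weierstrass points\<close>

lemma linear_in_function_field: "aff.ev [:- a, 1:] \<in> function_field g \<alpha> - {0}"
  using ev_in_function_field by simp

lemma conjugate_on_curve: "Aff a b \<in> hcurve g \<alpha> \<Longrightarrow> Aff a (- b) \<in> hcurve g \<alpha>"
  by (simp add: hcurve_def)

lemma neq_conjugate: "b \<noteq> 0 \<Longrightarrow> b \<noteq> - (b::'a)"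
  using two by (metis add_eq_0_iff mult_2 mult_eq_0_iff)

text \<open>
  Suppose \<open>2D - (P) + (\<infinity>) = div h\<close> with \<open>P = (a, b)\<close>. Multiplication by \<open>x - a\<close> cancels the only
  possible affine pole, and the pole at infinity stays below \<open>2g + 1\<close>; hence \<open>h (x - a)\<close>,
  and with it \<open>h\<close>, is a function of \<open>x\<close> alone. If \<open>b = 0\<close>, such a function has even order at \<open>P\<close>;
  if \<open>b \<noteq> 0\<close>, it has the same order at \<open>P\<close> and at \<open>(a, -b)\<close>. Both contradict the parities of
  \<open>2D - (P)\<close> at these points.
\<close>
lemma double_not_equivalent_affine_point:
  assumes eff: "\<And>R. R \<noteq> Infty \<Longrightarrow> Poly_Mapping.lookup D R \<ge> 0"
    and inf: "Poly_Mapping.lookup D Infty \<ge> - (int g - 1)"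
    and P: "Aff a b \<in> hcurve g \<alpha>"
  shows "D + D - (frag_of (Aff a b) - frag_of Infty) \<notin> Prin"
proof
  assume "D + D - (frag_of (Aff a b) - frag_of Infty) \<in> Prin"
  then obtain h where h: "h \<in> function_field g \<alpha> - {0}"
    and ord: "\<And>R. R \<in> hcurve g \<alpha> \<Longrightarrow>
        Poly_Mapping.lookup (D + D - (frag_of (Aff a b) - frag_of Infty)) R = ord_at g \<alpha> R h"
    by (rule principalE) blast
  have ord_aff: "ord_at g \<alpha> (Aff c d) h = 2 * Poly_Mapping.lookup D (Aff c d) - (if c = a \<and> d = b then 1 else 0)"
    if "Aff c d \<in> hcurve g \<alpha>" for c d
    using ord[OF that] by (simp add: lookup_add lookup_minus)
  have ord_inf: "ord_at g \<alpha> Infty h = 2 * Poly_Mapping.lookup D Infty + 1"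
    using ord[OF Infty_on_curve] by (simp add: lookup_add lookup_minus)
  define k where "k = aff.ev [:- a, 1:]"
  have k: "k \<in> function_field g \<alpha> - {0}" unfolding k_def by (rule linear_in_function_field)
  have hk: "h * k \<in> function_field g \<alpha> - {0}" using h k function_field_mult by auto
  have "\<exists>p. p \<noteq> 0 \<and> h * k = aff.ev p"
  proof (rule low_pole_imp_polynomial[OF hk])
    fix c d assume R: "Aff c d \<in> hcurve g \<alpha>"
    show "ord_at g \<alpha> (Aff c d) (h * k) \<ge> 0"
      using eff[of "Aff c d"] ord_at_mult[OF R h k] ord_aff[OF R] ord_at_ev_aff[OF R, of "[:- a, 1:]"]
      by (auto simp: k_def order_linear split: if_splits)
  next
    show "ord_at g \<alpha> Infty (h * k) \<ge> - 2 * int g"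
      using inf ord_inf ord_at_mult[OF Infty_on_curve h k] ord_at_ev_inf[of "[:- a, 1:]"]
      by (simp add: k_def)
  qed
  then obtain p where p: "p \<noteq> 0" "h * k = aff.ev p" by blast
  have ord_h: "ord_at g \<alpha> (Aff a d) h = (if d = 0 then 2 else 1) * (int (order a p) - 1)"
    if "Aff a d \<in> hcurve g \<alpha>" for d
    using ord_at_mult[OF that h k] ord_at_ev_aff[OF that p(1)] ord_at_ev_aff[OF that, of "[:- a, 1:]"]
    by (simp add: p(2) order_linear flip: k_def split: if_splits)
  show False
  proof (cases "b = 0")
    case True
    then show False using ord_h[OF P] ord_aff[OF P] by (simp) presburger
  next
    case False
    then show False
      using ord_h[OF P] ord_aff[OF P] ord_h[OF conjugate_on_curve[OF P]] ord_aff[OF conjugate_on_curve[OF P]]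
        neq_conjugate[of b]
      by simp presburger
  qed
qed

text \<open>
  A function with divisor \<open>2(P) - 2(\<infinity>)\<close> is a polynomial in \<open>x\<close>, so its divisor is invariant under
  \<open>y \<mapsto> -y\<close>.
\<close>
lemma two_torsion_imp_weierstrass:
  assumes "g \<ge> 1" and P: "Aff a b \<in> hcurve g \<alpha>"
    and "(frag_of (Aff a b) - frag_of Infty) + (frag_of (Aff a b) - frag_of Infty) \<in> Prin"
  shows "b = 0"
proof (rule ccontr)
  assume b: "b \<noteq> 0"
  obtain h where h: "h \<in> function_field g \<alpha> - {0}"
    and ord: "\<And>R. R \<in> hcurve g \<alpha> \<Longrightarrow>
        Poly_Mapping.lookup ((frag_of (Aff a b) - frag_of Infty) + (frag_of (Aff a b) - frag_of Infty)) R = ord_at g \<alpha> R h"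
    using assms(3) by (rule principalE) blast
  have ord_aff: "ord_at g \<alpha> (Aff c d) h = (if c = a \<and> d = b then 2 else 0)"
    if "Aff c d \<in> hcurve g \<alpha>" for c d
    using ord[OF that] by (cases "c = a \<and> d = b") (auto simp: lookup_add lookup_minus)
  have "ord_at g \<alpha> Infty h = - 2"
    using ord[OF Infty_on_curve] by (simp add: lookup_add lookup_minus)
  then obtain p where p: "p \<noteq> 0" "h = aff.ev p"
    using low_pole_imp_polynomial[OF h] ord_aff assms(1) by force
  then have "ord_at g \<alpha> (Aff a b) h = ord_at g \<alpha> (Aff a (- b)) h"
    using ord_at_ev_aff P conjugate_on_curve[OF P] by simp
  then show False using ord_aff[OF P] ord_aff[OF conjugate_on_curve[OF P]] neq_conjugate[OF b] by simp
qed

text \<open>The divisor of \<open>x - \<alpha>\<^sub>i\<close> is \<open>2(W\<^sub>i) - 2(\<infinity>)\<close>.\<close>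
lemma weierstrass_two_torsion:
  assumes "i \<in> {1..2 * g + 1}"
  defines "W \<equiv> Aff (\<alpha> i) 0"
  shows "(frag_of W - frag_of Infty) + (frag_of W - frag_of Infty) \<in> Prin"
proof (rule principalI[OF _ linear_in_function_field])
  have root: "poly f (\<alpha> i) = 0" using assms poly_f_eq_0_iff by blast
  then have "W \<in> hcurve g \<alpha>" by (simp add: hcurve_def W_def)
  then show "(frag_of W - frag_of Infty) + (frag_of W - frag_of Infty) \<in> carrier Div"
    using Div_add embed_in_Div by blast
  fix R assume R: "R \<in> hcurve g \<alpha>"
  show "Poly_Mapping.lookup ((frag_of W - frag_of Infty) + (frag_of W - frag_of Infty)) R =
      ord_at g \<alpha> R (aff.ev [:- \<alpha> i, 1:])"
  proof (cases R)
    case Infty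
    then show ?thesis using ord_at_ev_inf[of "[:- \<alpha> i, 1:]"]
      by (simp add: lookup_add lookup_minus W_def)
  next
    case (Aff c d)
    then have "c = \<alpha> i \<Longrightarrow> d = 0" using R root by (simp add: hcurve_def)
    then show ?thesis using ord_at_ev_aff[of c d "[:- \<alpha> i, 1:]"] R Aff
      by (auto simp: lookup_add lookup_minus W_def order_linear)
  qed
qed

end

theorem theorem2p4:
  fixes g :: nat and \<alpha> :: "nat \<Rightarrow> 'a::alg_closed_field"
  assumes "CHAR('a) \<noteq> 2"
    and "g > 1"
    and "inj_on \<alpha> {1..2 * g + 1}"
  shows "(\<forall>z \<in> jac_half_curve g \<alpha> \<inter> theta_divisor g \<alpha>.
            z [^]\<^bsub>jacobian g \<alpha>\<^esub> (2::nat) = \<one>\<^bsub>jacobian g \<alpha>\<^esub>) \<and>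
         jac_curve g \<alpha> \<inter> jac_half_curve g \<alpha> =
           jac_embed g \<alpha> ` ({Infty} \<union> {Aff (\<alpha> i) 0 | i. i \<in> {1..2 * g + 1}})"
proof -
  interpret hyperelliptic g \<alpha>
  proof
    have "\<not> CHAR('a) dvd 2"
      using assms(1) CHAR_not_1'[where 'a = 'a] by (metis One_nat_def prime_nat_iff two_is_prime_nat)
    then show "(2::'a) \<noteq> 0" using of_nat_eq_0_iff_char_dvd[of 2, where 'a = 'a] by simp
  qed (fact assms)
  \<comment> \<open>The form of the first claim that serves both parts: \<open>D\<close> is either \<open>\<Sum>\<^sub>i ((Q\<^sub>i) - (\<infinity>))\<close> with \<open>g - 1\<close>
    points or, as \<open>g > 1\<close>, a single \<open>(P) - (\<infinity>)\<close>.\<close>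
  have double: "cl g \<alpha> (D + D) = \<one>\<^bsub>Jac\<^esub>"
    if D: "D \<in> carrier Div" "\<And>R. R \<noteq> Infty \<Longrightarrow> Poly_Mapping.lookup D R \<ge> 0"
      "Poly_Mapping.lookup D Infty \<ge> - (int g - 1)"
    and curve: "cl g \<alpha> (D + D) \<in> jac_curve g \<alpha>" for D
  proof -
    obtain P where P: "P \<in> hcurve g \<alpha>" "cl g \<alpha> (D + D) = cl g \<alpha> (frag_of P - frag_of Infty)"
      using curve by (auto simp: jac_curve_def jac_embed_def)
    then have "D + D - (frag_of P - frag_of Infty) \<in> Prin"
      using cl_eq_iff D(1) Div_add embed_in_Div by blast
    then have "P = Infty" using double_not_equivalent_affine_point[OF D(2,3)] P by (cases P) auto
    then show ?thesis using P(2) by (simp add: cl_0)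
  qed
  have "z [^]\<^bsub>Jac\<^esub> (2::nat) = \<one>\<^bsub>Jac\<^esub>" if z: "z \<in> jac_half_curve g \<alpha>" "z \<in> theta_divisor g \<alpha>" for z
  proof -
    obtain Q where Q: "Q \<in> {1..g - 1} \<rightarrow> hcurve g \<alpha>"
      and zQ: "z = finprod Jac (\<lambda>i. jac_embed g \<alpha> (Q i)) {1..g - 1}"
      using z(2) by (auto simp: jac_theta_def)
    define D where "D = (\<Sum>i = 1..g - 1. frag_of (Q i) - frag_of Infty)"
    have D: "z = cl g \<alpha> D" "D \<in> carrier Div" "div_degree D = 0"
      using finprod_embed[OF _ Q] zQ by (auto simp: D_def)
    have lookup: "Poly_Mapping.lookup D R =
        (\<Sum>i = 1..g - 1. (if R = Q i then 1 else 0) - (if R = Infty then 1 else 0))" for R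
      by (simp add: D_def Poly_Mapping.lookup_sum lookup_minus)
    have "Poly_Mapping.lookup D Infty \<ge> (\<Sum>i = 1..g - 1. - 1)"
      unfolding lookup by (intro sum_mono) auto
    then have "Poly_Mapping.lookup D Infty \<ge> - (int g - 1)" using assms(2) by simp
    moreover have "Poly_Mapping.lookup D R \<ge> 0" if "R \<noteq> Infty" for R
      unfolding lookup using that by (intro sum_nonneg) auto
    moreover have "cl g \<alpha> (D + D) \<in> jac_curve g \<alpha>"
      using z(1) D by (auto simp: jac_half_curve_def square_cl)
    ultimately show ?thesis using double D square_cl by simp
  qed
  moreover have "jac_curve g \<alpha> \<inter> jac_half_curve g \<alpha> =
           jac_embed g \<alpha> ` ({Infty} \<union> {Aff (\<alpha> i) 0 | i. i \<in> {1..2 * g + 1}})" (is "?L = jac_embed g \<alpha> ` ?W")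
  proof (intro equalityI subsetI)
    fix z assume z: "z \<in> ?L"
    then obtain P where P: "P \<in> hcurve g \<alpha>" "z = jac_embed g \<alpha> P" by (auto simp: jac_curve_def)
    define D where "D = frag_of P - frag_of Infty"
    have D: "D \<in> carrier Div" "div_degree D = 0" "z = cl g \<alpha> D"
      using embed_in_Div P div_degree_embed by (auto simp: D_def jac_embed_def simp del: carrier_free_Abelian_group_iff)
    have "cl g \<alpha> (D + D) = \<one>\<^bsub>Jac\<^esub>"
    proof (rule double[OF D(1)])
      show "cl g \<alpha> (D + D) \<in> jac_curve g \<alpha>" using z D by (auto simp: jac_half_curve_def square_cl)
    qed (use assms(2) in \<open>auto simp: D_def lookup_minus\<close>)
    then have prin: "D + D \<in> Prin" using cl_eq_iff[of "D + D" 0] D(1) Div_add cl_0 by simp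
    have "P \<in> ?W"
    proof (cases P)
      case (Aff a b)
      then have "b = 0" using two_torsion_imp_weierstrass P prin assms(2) by (simp add: D_def)
      moreover from this have "poly f a = 0" using P Aff by (simp add: hcurve_def)
      ultimately show ?thesis using Aff poly_f_eq_0_iff by auto
    qed simp
    then show "z \<in> jac_embed g \<alpha> ` ?W" using P by blast
  next
    fix z assume "z \<in> jac_embed g \<alpha> ` ?W"
    then obtain P where P: "P \<in> ?W" "z = jac_embed g \<alpha> P" by blast
    define D where "D = frag_of P - frag_of Infty"
    have "poly f (\<alpha> i) = 0" if "i \<in> {1..2 * g + 1}" for i using that poly_f_eq_0_iff by blast
    then have curve: "P \<in> hcurve g \<alpha>" using P by (auto simp: hcurve_def)
    have D: "D \<in> carrier Div" "div_degree D = 0" "z = cl g \<alpha> D"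
      using embed_in_Div curve P div_degree_embed by (auto simp: D_def jac_embed_def simp del: carrier_free_Abelian_group_iff)
    have "D + D \<in> Prin"
      using P weierstrass_two_torsion subgroup.one_closed[OF principal_subgroup] by (auto simp: D_def)
    then have "cl g \<alpha> (D + D) = \<one>\<^bsub>Jac\<^esub>" using cl_eq_iff[of "D + D" 0] D(1) Div_add cl_0 by simp
    also have "\<dots> = jac_embed g \<alpha> Infty" by (simp add: jac_embed_def cl_0)
    finally have "z [^]\<^bsub>Jac\<^esub> (2::nat) \<in> jac_curve g \<alpha>"
      using D Infty_on_curve by (simp add: square_cl jac_curve_def)
    then show "z \<in> ?L" using D curve P by (auto simp: jac_half_curve_def jac_curve_def jacobian_simps(1))
  qed
  ultimately show ?thesis by blast
qed

end
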